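(* Let $\mathcal S$ be the state space of the operator system $C(S^1)^{(n)}$ of $n\times n$ Toeplitz matrices, with distance function $d$ defined by the truncated Dirac operator. (i) The distance function on $\mathcal S$ is given, for $\phi,\psi\in\mathcal S$ and primitives $\Phi$, $\partial^t\Phi=\phi$, and $\Psi$, $\partial^t\Psi=\psi$, by $$d(\phi,\psi)=\inf_{c\in\mathbb R}\|\Psi-\Phi-c\|^*.$$ (ii) The distance function on $\mathcal S$ is larger than the Kantorovich distance $d_T(\phi,\psi)$ of the associated probability measures on the circle.
   Context: $n$ is a positive integer. $C(S^1)^{(n)}_{\mathrm{sa}}$ is the real space of self-adjoint Toeplitz matrices $A=(t_{k-l})_{1\le k,l\le n}$ and $D=\mathrm{diag}(1,2,\dots,n)$ is the truncation of the Dirac operator $-i\,d/dx$ to $\mathrm{span}\{e^{ikx}\}_{k=1}^n$. Set $\partial A:=i[D,A]$. The distance is $$d(\phi,\psi)=\sup\{|\phi(A)-\psi(A)|:A\in C(S^1)^{(n)}_{\mathrm{sa}},\ \|[D,A]\|\le1\}.$$ $C^*(\mathbb Z)_{(n)}$ is the space of sequences $a=(a_k)_{k\in\mathbb Z}$ supported in $(-n,n)$; $(C^*(\mathbb Z)_{(n)})_{\mathrm{sa}}$ consists of those with $a_{-k}=\overline{a_k}$, and is identified with the real dual of $C(S^1)^{(n)}_{\mathrm{sa}}$ by $a(T)=\sum_ka_kt_{-k}$ for $T=(t_{k-l})$. $\partial^t$ is the transpose of $\partial$, acting on $(C^*(\mathbb Z)_{(n)})_{\mathrm{sa}}$ by $(\partial^ta)(A)=a(\partial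 A)$; a primitive of a functional $\omega$ is an element $\Omega$ with $\partial^t\Omega=\omega$. A real number $c$ is identified with $c\,\delta_0\in(C^*(\mathbb Z)_{(n)})_{\mathrm{sa}}$. $\|a\|^*=\sup\{|a(T)|:T\in C(S^1)^{(n)}_{\mathrm{sa}},\|T\|\le1\}$ is the norm dual to the Toeplitz operator norm. A state $\phi\in\mathcal S$ corresponds to $a\in C^*(\mathbb Z)_{(n)}$ with $a_0=1$ and $a(z)=\sum_ka_kz^k\ge0$ on $S^1$; its associated probability measure is $a(z)\frac{|dz|}{2\pi}$. $d_T$ is the Kantorovich (Wasserstein-1) distance between probability measures on $S^1=\mathbb R/2\pi\mathbb Z$ for the geodesic distance.
   Formalization: No state has a primitive in the literal sense, since elements in the range of ∂^t have zero constant term while a state has a_0 = 1; primitives are therefore taken modulo a common real constant r: ∂^tΦ = φ − r, ∂^tΨ = ψ − r (r = 1 is the case that occurs). *)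

theory Defs
  imports "HOL-Analysis.Analysis" "Jordan_Normal_Form.Schur_Decomposition"
begin

definition toeplitz_mat :: "nat \<Rightarrow> (int \<Rightarrow> complex) \<Rightarrow> complex mat" where
  "toeplitz_mat n t = mat n n (\<lambda>(k, l). t (int k - int l))"

definition toeplitz :: "nat \<Rightarrow> complex mat set" where
  "toeplitz n = range (toeplitz_mat n)"

definition toeplitz_sa :: "nat \<Rightarrow> complex mat set" where
  "toeplitz_sa n = {A \<in> toeplitz n. mat_adjoint A = A}"

(* The entry t_m on the m-th diagonal, read off the first column (m >= 0) or the first row. *)
definition diagonal_entry :: "complex mat \<Rightarrow> int \<Rightarrow> complex" where
  "diagonal_entry A m = (if m \<ge> 0 then A $$ (nat m, 0) else A $$ (0, nat (- m)))"

definition l2norm :: "complex vec \<Rightarrow> real" where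
  "l2norm v = sqrt (Re (v \<bullet>c v))"

definition opnorm :: "complex mat \<Rightarrow> real" where
  "opnorm A = (SUP v \<in> {v \<in> carrier_vec (dim_col A). l2norm v \<le> 1}. l2norm (A *\<^sub>v v))"

definition positive_semidefinite :: "complex mat \<Rightarrow> bool" where
  "positive_semidefinite A \<longleftrightarrow> (\<forall>v \<in> carrier_vec (dim_col A). 0 \<le> (A *\<^sub>v v) \<bullet>c v)"

(* Rows and columns are numbered from 0 here, hence diag(1,...,n) has Suc k in place k. *)
definition Dirac :: "nat \<Rightarrow> complex mat" where
  "Dirac n = mat_diag n (\<lambda>k. of_nat (Suc k))"

definition Dirac_commutator :: "nat \<Rightarrow> complex mat \<Rightarrow> complex mat" where
  "Dirac_commutator n A = Dirac n * A - A * Dirac n"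

definition derivation :: "nat \<Rightarrow> complex mat \<Rightarrow> complex mat" where
  "derivation n A = \<i> \<cdot>\<^sub>m Dirac_commutator n A"

definition dual_seq :: "nat \<Rightarrow> (int \<Rightarrow> complex) set" where
  "dual_seq n = {a. \<forall>k. k \<notin> {- int n<..<int n} \<longrightarrow> a k = 0}"

definition dual_seq_sa :: "nat \<Rightarrow> (int \<Rightarrow> complex) set" where
  "dual_seq_sa n = {a \<in> dual_seq n. \<forall>k. a (- k) = cnj (a k)}"

definition pairing :: "nat \<Rightarrow> (int \<Rightarrow> complex) \<Rightarrow> complex mat \<Rightarrow> complex" where
  "pairing n a A = (\<Sum>k\<in>{- int n<..<int n}. a k * diagonal_entry A (- k))"

definition const_seq :: "real \<Rightarrow> int \<Rightarrow> complex" where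
  "const_seq c = (\<lambda>k. if k = 0 then of_real c else 0)"

definition dual_norm :: "nat \<Rightarrow> (int \<Rightarrow> complex) \<Rightarrow> real" where
  "dual_norm n a = (SUP A \<in> {A \<in> toeplitz_sa n. opnorm A \<le> 1}. cmod (pairing n a A))"

(* Well defined on dual_seq_sa n, where derivation_transpose_eq gives the explicit formula. *)
definition derivation_transpose :: "nat \<Rightarrow> (int \<Rightarrow> complex) \<Rightarrow> (int \<Rightarrow> complex)" where
  "derivation_transpose n a =
     (THE b. b \<in> dual_seq_sa n \<and>
             (\<forall>A \<in> toeplitz_sa n. pairing n b A = pairing n a (derivation n A)))"

definition is_primitive :: "nat \<Rightarrow> (int \<Rightarrow> complex) \<Rightarrow> (int \<Rightarrow> complex) \<Rightarrow> bool" where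
  "is_primitive n \<Omega> \<omega> \<longleftrightarrow> \<Omega> \<in> dual_seq_sa n \<and> derivation_transpose n \<Omega> = \<omega>"

(* Unital positive functionals on the operator system; see state_symbol_nonneg. *)
definition states :: "nat \<Rightarrow> (int \<Rightarrow> complex) set" where
  "states n = {a \<in> dual_seq_sa n. pairing n a (1\<^sub>m n) = 1 \<and>
                 (\<forall>A \<in> toeplitz n. positive_semidefinite A \<longrightarrow> 0 \<le> pairing n a A)}"

definition state_dist :: "nat \<Rightarrow> (int \<Rightarrow> complex) \<Rightarrow> (int \<Rightarrow> complex) \<Rightarrow> real" where
  "state_dist n \<phi> \<psi> = (SUP A \<in> {A \<in> toeplitz_sa n. opnorm (Dirac_commutator n A) \<le> 1}.
                          cmod (pairing n \<phi> A - pairing n \<psi> A))"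

definition symbol :: "nat \<Rightarrow> (int \<Rightarrow> complex) \<Rightarrow> complex \<Rightarrow> complex" where
  "symbol n a z = (\<Sum>k\<in>{- int n<..<int n}. a k * z powi k)"

(* The circle is the unit circle of the complex plane, with its Borel sets. *)
definition circle_space :: "complex measure" where
  "circle_space = restrict_space borel (sphere 0 1)"

(* a(z) |dz| / (2 pi), as the image under x |-> e^(ix) of a measure on [0, 2 pi) *)
definition circle_measure :: "nat \<Rightarrow> (int \<Rightarrow> complex) \<Rightarrow> complex measure" where
  "circle_measure n a =
     distr (density (restrict_space lborel {0..<2*pi}) (\<lambda>x. ennreal (Re (symbol n a (cis x)) / (2*pi))))
           circle_space cis"

(* Arg takes values in (-pi, pi], so this is the arc length metric of R / 2 pi Z. *)
definition geodesic_dist :: "complex \<Rightarrow> complex \<Rightarrow> real" where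
  "geodesic_dist z w = \<bar>Arg (z / w)\<bar>"

definition couplings :: "'a measure \<Rightarrow> 'a measure \<Rightarrow> ('a \<times> 'a) measure set" where
  "couplings \<mu> \<nu> = {\<pi>. sets \<pi> = sets (\<mu> \<Otimes>\<^sub>M \<nu>) \<and> distr \<pi> \<mu> fst = \<mu> \<and> distr \<pi> \<nu> snd = \<nu>}"

definition kantorovich_dist :: "complex measure \<Rightarrow> complex measure \<Rightarrow> ennreal" where
  "kantorovich_dist \<mu> \<nu> = (INF \<pi> \<in> couplings \<mu> \<nu>. \<integral>\<^sup>+ p. ennreal (geodesic_dist (fst p) (snd p)) \<partial>\<pi>)"

lemma diagonal_entry_toeplitz_mat:
  assumes "k \<in> {- int n<..<int n}"
  shows "diagonal_entry (toeplitz_mat n t) k = t k"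
  using assms by (auto simp: diagonal_entry_def toeplitz_mat_def)

lemma pairing_toeplitz_mat:
  "pairing n a (toeplitz_mat n t) = (\<Sum>k\<in>{- int n<..<int n}. a k * t (- k))"
  unfolding pairing_def by (intro sum.cong refl) (subst diagonal_entry_toeplitz_mat, auto)

lemma derivation_toeplitz_mat:
  "derivation n (toeplitz_mat n t) = toeplitz_mat n (\<lambda>k. \<i> * of_int k * t k)"
proof (rule eq_matI)
  fix i j assume "i < dim_row (toeplitz_mat n (\<lambda>k. \<i> * of_int k * t k))"
    "j < dim_col (toeplitz_mat n (\<lambda>k. \<i> * of_int k * t k))"
  then have ij: "i < n" "j < n" by (auto simp: toeplitz_mat_def)
  have "toeplitz_mat n t \<in> carrier_mat n n" by (simp add: toeplitz_mat_def)
  then show "derivation n (toeplitz_mat n t) $$ (i, j)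
      = toeplitz_mat n (\<lambda>k. \<i> * of_int k * t k) $$ (i, j)"
    using ij unfolding derivation_def Dirac_commutator_def Dirac_def
    by (simp add: mat_diag_mult_left mat_diag_mult_right)
       (simp add: toeplitz_mat_def algebra_simps)
qed (auto simp: derivation_def Dirac_commutator_def Dirac_def toeplitz_mat_def mat_diag_def)

lemma toeplitz_mat_sa:
  assumes "\<And>k. t (- k) = cnj (t k)"
  shows "toeplitz_mat n t \<in> toeplitz_sa n"
proof -
  have "mat_adjoint (toeplitz_mat n t) = toeplitz_mat n t"
  proof (rule eq_matI)
    fix i j assume "i < dim_row (toeplitz_mat n t)" "j < dim_col (toeplitz_mat n t)"
    then have "i < n" "j < n" by (auto simp: toeplitz_mat_def)
    then show "mat_adjoint (toeplitz_mat n t) $$ (i, j) = toeplitz_mat n t $$ (i, j)"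
      using assms[of "int j - int i"]
      by (simp add: mat_adjoint_def toeplitz_mat_def mat_of_rows_index)
  qed (auto simp: mat_adjoint_def toeplitz_mat_def)
  then show ?thesis by (simp add: toeplitz_sa_def toeplitz_def)
qed

lemma derivation_transpose_eq:
  assumes "a \<in> dual_seq_sa n"
  shows "derivation_transpose n a = (\<lambda>k. - \<i> * of_int k * a k)"
  unfolding derivation_transpose_def
proof (rule the_equality)
  have "pairing n (\<lambda>k. - \<i> * of_int k * a k) A = pairing n a (derivation n A)"
    if "A \<in> toeplitz_sa n" for A
  proof -
    from that obtain t where A: "A = toeplitz_mat n t"
      by (auto simp: toeplitz_sa_def toeplitz_def)
    show ?thesis
      unfolding A derivation_toeplitz_mat pairing_toeplitz_mat by (simp add: mult_ac)
  qed
  then show *: "(\<lambda>k. - \<i> * of_int k * a k) \<in> dual_seq_sa n \<and>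
    (\<forall>A\<in>toeplitz_sa n. pairing n (\<lambda>k. - \<i> * of_int k * a k) A = pairing n a (derivation n A))"
    using assms by (auto simp: dual_seq_sa_def dual_seq_def)
  fix b assume b: "b \<in> dual_seq_sa n \<and>
    (\<forall>A\<in>toeplitz_sa n. pairing n b A = pairing n a (derivation n A))"
  define e where "e = (\<lambda>k. b k + \<i> * of_int k * a k)"
  have e: "e (- k) = cnj (e k)" for k
    using assms b by (auto simp: e_def dual_seq_sa_def)
  have "toeplitz_mat n e \<in> toeplitz_sa n"
    by (rule toeplitz_mat_sa) (rule e)
  with b * have "pairing n b (toeplitz_mat n e)
      = pairing n (\<lambda>k. - \<i> * of_int k * a k) (toeplitz_mat n e)" by simp
  then have "(\<Sum>k\<in>{- int n<..<int n}. b k * e (- k) - (- \<i> * of_int k * a k) * e (- k)) = 0"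
    unfolding pairing_toeplitz_mat sum_subtractf by simp
  then have "(\<Sum>k\<in>{- int n<..<int n}. e k * e (- k)) = 0"
    by (simp add: e_def distrib_right)
  then have "of_real (\<Sum>k\<in>{- int n<..<int n}. (cmod (e k))\<^sup>2) = (0 :: complex)"
    by (simp only: of_real_sum complex_norm_square e)
  then have "(\<Sum>k\<in>{- int n<..<int n}. (cmod (e k))\<^sup>2) = 0"
    by (simp only: of_real_eq_0_iff)
  then have "e k = 0" if "k \<in> {- int n<..<int n}" for k
    using that by (subst (asm) sum_nonneg_eq_0_iff) auto
  moreover have "e k = 0" if "k \<notin> {- int n<..<int n}" for k
    using that b assms by (simp add: e_def dual_seq_sa_def dual_seq_def del: greaterThanLessThan_iff)
  ultimately have "e k = 0" for k by blast
  then show "b = (\<lambda>k. - \<i> * of_int k * a k)"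
    by (auto simp: e_def fun_eq_iff add_eq_0_iff)
qed

lemma state_zero_coeff:
  assumes "n > 0" "a \<in> states n"
  shows "a 0 = 1"
proof -
  have "1\<^sub>m n = toeplitz_mat n (\<lambda>k. if k = 0 then 1 else 0)"
    by (rule eq_matI) (auto simp: toeplitz_mat_def)
  then have "pairing n a (1\<^sub>m n) = (\<Sum>k\<in>{- int n<..<int n}. if k = 0 then a k else 0)"
    by (simp only: pairing_toeplitz_mat) (intro sum.cong, auto)
  then show ?thesis using assms by (simp add: states_def)
qed

lemma state_symbol_nonneg:
  assumes "a \<in> states n" "cmod z = 1"
  shows "0 \<le> symbol n a z"
proof -
  define T where "T = toeplitz_mat n (\<lambda>k. z powi (- k))"
  have z: "z \<noteq> 0" "cnj z = inverse z"
    using assms(2) divide_conv_cnj[of z 1] by (auto simp: divide_inverse)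
  have "0 \<le> (T *\<^sub>v v) \<bullet>c v" if v: "v \<in> carrier_vec n" for v
  proof -
    define s where "s = (\<Sum>l<n. z ^ l * vec_index v l)"
    have "(T *\<^sub>v v) \<bullet>c v
        = (\<Sum>k<n. (\<Sum>l<n. z powi (int l - int k) * vec_index v l) * cnj (vec_index v k))"
      using v by (simp add: T_def toeplitz_mat_def scalar_prod_def lessThan_atLeast0)
    also have "\<dots> = (\<Sum>k<n. s * cnj (z ^ k * vec_index v k))"
      using z by (intro sum.cong refl)
        (simp add: s_def power_int_diff divide_inverse power_inverse sum_distrib_left sum_distrib_right mult_ac)
    also have "\<dots> = s * cnj s" by (simp add: s_def sum_distrib_left)
    also have "\<dots> = of_real ((cmod s)\<^sup>2)" by (simp only: complex_norm_square)
    finally show ?thesis by (simp add: less_eq_complex_def)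
  qed
  then have "positive_semidefinite T"
    by (simp add: positive_semidefinite_def T_def toeplitz_mat_def)
  then have "0 \<le> pairing n a T"
    using assms(1) by (auto simp: states_def T_def toeplitz_def)
  then show ?thesis by (simp add: T_def pairing_toeplitz_mat symbol_def)
qed

(* A state is not itself in the range of the transpose, whose elements have no constant term.
   It has a primitive after subtraction of its constant term 1, so primitives of states are to be
   taken modulo a real constant. *)

lemma state_no_primitive:
  assumes "n > 0" "\<phi> \<in> states n"
  shows "\<not> is_primitive n \<Phi> \<phi>"
  using state_zero_coeff[OF assms] by (auto simp: is_primitive_def derivation_transpose_eq)

lemma state_primitive:
  assumes "n > 0" "\<phi> \<in> states n"
  shows "\<exists>\<Phi>. is_primitive n \<Phi> (\<phi> - const_seq 1)"
proof
  let ?\<Phi> = "\<lambda>k. \<i> * \<phi> k / of_int k"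
  have "?\<Phi> \<in> dual_seq_sa n"
    using assms(2) by (auto simp: states_def dual_seq_sa_def dual_seq_def)
  then show "is_primitive n ?\<Phi> (\<phi> - const_seq 1)"
    using state_zero_coeff[OF assms]
    by (auto simp: is_primitive_def derivation_transpose_eq const_seq_def fun_eq_iff)
qed

end

theory Submission
  imports Defs
begin

text \<open>
  (i) Through the primitives, \<open>d(\<phi>, \<psi>)\<close> is the norm of \<open>\<Psi> - \<Phi>\<close> restricted to the Toeplitz matrices
  with vanishing diagonal, because these are exactly the derivatives. That space has codimension one,
  and one step of the Hahn-Banach extension gives the infimum over constants.

  (ii) By (i) it is enough to bound the Kantorovich distance by \<open>\<parallel>\<Psi> - \<Phi> - c\<parallel>\<^sup>*\<close> for every \<open>c\<close>. Testing
  against the Toeplitz matrix of the function \<open>sgn (\<Psi> - \<Phi> - c)\<close>, a contraction, bounds this dual norm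
  from below by the normalised \<open>L\<^sup>1\<close> norm of \<open>\<Psi> - \<Phi> - c\<close>. On the other hand \<open>x - \<Phi>(x)\<close> and
  \<open>x - \<Psi>(x)\<close> are, up to the factor \<open>2\<pi>\<close>, distribution functions of the two measures, and the quantile
  coupling, with the circle cut at a suitable point, transports one to the other at a cost of at most
  that \<open>L\<^sup>1\<close> norm.
\<close>

subsection \<open>The operator norm\<close>

lemma l2norm_L2_set: "l2norm v = L2_set (\<lambda>i. cmod (vec_index v i)) {..<dim_vec v}"
proof -
  have "v \<bullet>c v = (\<Sum>i<dim_vec v. of_real ((cmod (vec_index v i))\<^sup>2))"
    unfolding complex_norm_square by (simp add: scalar_prod_def lessThan_atLeast0)
  then have "Re (v \<bullet>c v) = (\<Sum>i<dim_vec v. (cmod (vec_index v i))\<^sup>2)"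
    by (simp flip: of_real_sum)
  then show ?thesis by (simp add: l2norm_def L2_set_def)
qed

lemma l2norm_nonneg [simp]: "0 \<le> l2norm v"
  by (simp add: l2norm_L2_set)

lemma l2norm_power2: "(l2norm v)\<^sup>2 = Re (v \<bullet>c v)"
proof -
  have "0 \<le> Re (v \<bullet>c v)"
    using l2norm_nonneg[of v] unfolding l2norm_def by simp
  then show ?thesis by (simp add: l2norm_def)
qed

lemma cmod_le_l2norm: "i < dim_vec v \<Longrightarrow> cmod (vec_index v i) \<le> l2norm v"
  unfolding l2norm_L2_set by (rule member_le_L2_set) auto

lemma l2norm_smult: "l2norm (c \<cdot>\<^sub>v v) = cmod c * l2norm v"
  by (simp add: l2norm_L2_set norm_mult L2_set_right_distrib cong: L2_set_cong_simp)

lemma l2norm_triangle_diff: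
  assumes "v \<in> carrier_vec n" "w \<in> carrier_vec n"
  shows "l2norm (v - w) \<le> l2norm v + l2norm w"
proof -
  have "l2norm (v - w) = L2_set (\<lambda>i. cmod (vec_index v i - vec_index w i)) {..<n}"
    using assms by (simp add: l2norm_L2_set cong: L2_set_cong_simp)
  also have "\<dots> \<le> L2_set (\<lambda>i. cmod (vec_index v i) + cmod (vec_index w i)) {..<n}"
    by (intro L2_set_mono norm_triangle_ineq4) auto
  also have "\<dots> \<le> l2norm v + l2norm w"
    using assms L2_set_triangle_ineq[of "\<lambda>i. cmod (vec_index v i)" "\<lambda>i. cmod (vec_index w i)" "{..<n}"]
    by (simp add: l2norm_L2_set)
  finally show ?thesis .
qed

text \<open>A crude bound whose only purpose is to show that the supremum defining
  \<open>opnorm\<close> is taken over a bounded set; a real supremum can be used only after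
  that.\<close>

lemma l2norm_mult_mat_vec_le:
  assumes "v \<in> carrier_vec (dim_col A)" "l2norm v \<le> 1"
  shows "l2norm (A *\<^sub>v v) \<le> (\<Sum>i<dim_row A. \<Sum>j<dim_col A. cmod (A $$ (i, j)))"
proof -
  have "l2norm (A *\<^sub>v v) \<le> (\<Sum>i<dim_row A. cmod (vec_index (A *\<^sub>v v) i))"
    unfolding l2norm_L2_set by (rule order_trans[OF L2_set_le_sum]) auto
  also have "\<dots> \<le> (\<Sum>i<dim_row A. \<Sum>j<dim_col A. cmod (A $$ (i, j)))"
  proof (rule sum_mono)
    fix i assume "i \<in> {..<dim_row A}"
    then have "vec_index (A *\<^sub>v v) i = (\<Sum>j<dim_col A. A $$ (i, j) * vec_index v j)"
      using assms(1) by (simp add: scalar_prod_def lessThan_atLeast0)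
    also have "cmod \<dots> \<le> (\<Sum>j<dim_col A. cmod (A $$ (i, j)) * cmod (vec_index v j))"
      by (rule order_trans[OF norm_sum]) (simp add: norm_mult)
    also have "\<dots> \<le> (\<Sum>j<dim_col A. cmod (A $$ (i, j)))"
    proof (rule sum_mono)
      fix j assume "j \<in> {..<dim_col A}"
      then have "cmod (vec_index v j) \<le> 1"
        using assms cmod_le_l2norm[of j v] by auto
      then show "cmod (A $$ (i, j)) * cmod (vec_index v j) \<le> cmod (A $$ (i, j))"
        by (simp add: mult_left_le)
    qed
    finally show "cmod (vec_index (A *\<^sub>v v) i) \<le> (\<Sum>j<dim_col A. cmod (A $$ (i, j)))" .
  qed
  finally show ?thesis .
qed

lemma opnorm_upper:
  assumes "v \<in> carrier_vec (dim_col A)" "l2norm v \<le> 1"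
  shows "l2norm (A *\<^sub>v v) \<le> opnorm A"
  unfolding opnorm_def
proof (rule cSUP_upper)
  show "bdd_above ((\<lambda>v. l2norm (A *\<^sub>v v)) ` {v \<in> carrier_vec (dim_col A). l2norm v \<le> 1})"
    by (intro bdd_aboveI2[where M = "\<Sum>i<dim_row A. \<Sum>j<dim_col A. cmod (A $$ (i, j))"])
       (auto intro: l2norm_mult_mat_vec_le)
qed (use assms in auto)

lemma l2norm_zero [simp]: "l2norm (0\<^sub>v n) = 0"
  by (simp add: l2norm_L2_set L2_set_0')

lemma opnorm_least:
  assumes "\<And>v. v \<in> carrier_vec (dim_col A) \<Longrightarrow> l2norm v \<le> 1 \<Longrightarrow> l2norm (A *\<^sub>v v) \<le> c"
  shows "opnorm A \<le> c"
  unfolding opnorm_def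
proof (rule cSUP_least)
  have "0\<^sub>v (dim_col A) \<in> {v \<in> carrier_vec (dim_col A). l2norm v \<le> 1}" by simp
  then show "{v \<in> carrier_vec (dim_col A). l2norm v \<le> 1} \<noteq> {}" by blast
qed (use assms in auto)

lemma opnorm_nonneg [simp]: "0 \<le> opnorm A"
  by (rule order_trans[OF _ opnorm_upper[of "0\<^sub>v (dim_col A)"]]) auto

lemma opnorm_triangle_diff:
  assumes "A \<in> carrier_mat n n" "B \<in> carrier_mat n n"
  shows "opnorm (A - B) \<le> opnorm A + opnorm B"
proof (rule opnorm_least)
  fix v assume v: "v \<in> carrier_vec (dim_col (A - B))" "l2norm v \<le> 1"
  then have "(A - B) *\<^sub>v v = A *\<^sub>v v - B *\<^sub>v v"
    using assms by (intro minus_mult_distrib_mat_vec) auto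
  also have "l2norm \<dots> \<le> l2norm (A *\<^sub>v v) + l2norm (B *\<^sub>v v)"
    using assms v by (intro l2norm_triangle_diff[of _ n]) auto
  also have "\<dots> \<le> opnorm A + opnorm B"
    using assms v by (intro add_mono opnorm_upper) auto
  finally show "l2norm ((A - B) *\<^sub>v v) \<le> opnorm A + opnorm B" .
qed

text \<open>The inequality \<open>\<le>\<close> holds for every scalar and matrix; applied to
  \<open>inverse c\<close> and \<open>c \<cdot>\<^sub>m A\<close> it gives the reverse one for
  \<open>c \<noteq> 0\<close>.\<close>

lemma opnorm_smult: "opnorm (c \<cdot>\<^sub>m A) = cmod c * opnorm A"
proof -
  have le: "opnorm (c \<cdot>\<^sub>m A) \<le> cmod c * opnorm A" for c A
  proof (rule opnorm_least)
    fix v assume v: "v \<in> carrier_vec (dim_col (c \<cdot>\<^sub>m A))" "l2norm v \<le> 1"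
    then have "(c \<cdot>\<^sub>m A) *\<^sub>v v = c \<cdot>\<^sub>v (A *\<^sub>v v)"
      by (intro eq_vecI) (auto simp: scalar_prod_def sum_distrib_left mult.assoc)
    then show "l2norm ((c \<cdot>\<^sub>m A) *\<^sub>v v) \<le> cmod c * opnorm A"
      using v by (auto simp: l2norm_smult intro!: mult_left_mono opnorm_upper)
  qed
  show ?thesis
  proof (cases "c = 0")
    case True
    then show ?thesis using le[of c A] by (simp add: antisym)
  next
    case False
    then have "inverse c \<cdot>\<^sub>m (c \<cdot>\<^sub>m A) = A" by (intro eq_matI) auto
    then have "opnorm A \<le> inverse (cmod c) * opnorm (c \<cdot>\<^sub>m A)"
      using le[of "inverse c" "c \<cdot>\<^sub>m A"] by (simp add: norm_inverse)
    then have "cmod c * opnorm A \<le> opnorm (c \<cdot>\<^sub>m A)"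
      using False by (simp add: field_simps)
    then show ?thesis using le[of c A] by simp
  qed
qed

text \<open>An entry is a coordinate of the image of a unit vector. This is what later bounds every
  coefficient functional, and so every pairing, by the operator norm.\<close>

lemma cmod_entry_le_opnorm:
  assumes "i < dim_row A" "j < dim_col A"
  shows "cmod (A $$ (i, j)) \<le> opnorm A"
proof -
  have "A $$ (i, j) = vec_index (A *\<^sub>v unit_vec (dim_col A) j) i"
    using assms by (simp add: scalar_prod_right_unit)
  also have "cmod \<dots> \<le> l2norm (A *\<^sub>v unit_vec (dim_col A) j)"
    using assms by (intro cmod_le_l2norm) simp
  also have "\<dots> \<le> opnorm A"
  proof (rule opnorm_upper)
    have "(\<Sum>i<dim_col A. (cmod (if i = j then 1 else 0 :: complex))\<^sup>2) = (\<Sum>i<dim_col A. if i = j then 1 else 0)"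
      by (intro sum.cong) auto
    then show "l2norm (unit_vec (dim_col A) j) \<le> 1"
      using assms by (simp add: l2norm_L2_set L2_set_def unit_vec_def)
  qed simp
  finally show ?thesis .
qed

subsection \<open>Toeplitz matrices and the dual norm\<close>

lemma toeplitz_mat_carrier [simp]: "toeplitz_mat n t \<in> carrier_mat n n"
  by (simp add: toeplitz_mat_def)

lemma dim_toeplitz_mat [simp]: "dim_row (toeplitz_mat n t) = n" "dim_col (toeplitz_mat n t) = n"
  by (simp_all add: toeplitz_mat_def)

lemma toeplitz_mat_diff: "toeplitz_mat n (\<lambda>k. t k - u k) = toeplitz_mat n t - toeplitz_mat n u"
  by (rule eq_matI) (auto simp: toeplitz_mat_def)

lemma toeplitz_mat_smult: "toeplitz_mat n (\<lambda>k. c * t k) = c \<cdot>\<^sub>m toeplitz_mat n t"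
  by (rule eq_matI) (auto simp: toeplitz_mat_def)

lemma cmod_le_opnorm_toeplitz:
  assumes "k \<in> {- int n<..<int n}"
  shows "cmod (t k) \<le> opnorm (toeplitz_mat n t)"
proof -
  \<comment> \<open>Since \<open>nat\<close> sends negative integers to 0, this place lies in the
    first column if \<open>k \<ge> 0\<close> and in the first row if
    \<open>k \<le> 0\<close>.\<close>
  define i j where "i = nat k" and "j = nat (- k)"
  have "i < n" "j < n" "int i - int j = k"
    using assms by (auto simp: i_def j_def)
  then show ?thesis
    using cmod_entry_le_opnorm[of i "toeplitz_mat n t" j] by (simp add: toeplitz_mat_def)
qed

text \<open>The symmetry is demanded at all integers, although an n by n matrix sees only those in
  (-n,n), so that sequences can be handled without range conditions.\<close>

definition hermitian_seq :: "(int \<Rightarrow> complex) \<Rightarrow> bool" where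
  "hermitian_seq t \<longleftrightarrow> (\<forall>k. t (- k) = cnj (t k))"

text \<open>A Toeplitz matrix determines its sequence only on (-n,n). Setting the sequence to 0
  elsewhere makes it Hermitian everywhere and leaves the matrix unchanged.\<close>

lemma toeplitz_saE:
  assumes "A \<in> toeplitz_sa n"
  obtains t where "hermitian_seq t" "A = toeplitz_mat n t"
proof -
  obtain u where A: "A = toeplitz_mat n u" "mat_adjoint A = A"
    using assms by (auto simp: toeplitz_sa_def toeplitz_def)
  define t where "t k = (if k \<in> {- int n<..<int n} then u k else 0)" for k
  have "t (- k) = cnj (t k)" for k
  proof (cases "k \<in> {- int n<..<int n}")
    case True
    define i j where "i = nat k" and "j = nat (- k)"
    have ij: "i < n" "j < n" "int i - int j = k" "int j - int i = - k"
      using True by (auto simp: i_def j_def)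
    have "mat_adjoint A $$ (j, i) = cnj (A $$ (i, j))"
      using ij by (simp add: A(1) mat_adjoint_def toeplitz_mat_def mat_of_rows_index)
    then have "u (- k) = cnj (u k)"
      using ij unfolding A(2) by (simp add: A(1) toeplitz_mat_def)
    then show ?thesis using True by (simp add: t_def)
  qed (auto simp: t_def)
  moreover have "A = toeplitz_mat n t"
    unfolding A(1) by (rule eq_matI) (auto simp: toeplitz_mat_def t_def)
  ultimately show ?thesis by (intro that) (auto simp: hermitian_seq_def)
qed

lemma toeplitz_mat_hermitian: "hermitian_seq t \<Longrightarrow> toeplitz_mat n t \<in> toeplitz_sa n"
  by (rule toeplitz_mat_sa) (simp add: hermitian_seq_def)

lemma opnorm_zero [simp]: "opnorm (toeplitz_mat n (\<lambda>k. 0)) = 0"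
  using opnorm_smult[of 0 "toeplitz_mat n (\<lambda>k. 0)"] toeplitz_mat_smult[of n 0 "\<lambda>k. 0"] by simp

lemma zero_in_toeplitz_sa: "toeplitz_mat n (\<lambda>k. 0) \<in> toeplitz_sa n"
  by (rule toeplitz_mat_hermitian) (simp add: hermitian_seq_def)

text \<open>Continuity of the pairing in the operator norm: it makes the supremum in
  \<open>dual_norm\<close> one over a bounded set, and it makes the pairing vanish on matrices of
  norm 0.\<close>

lemma cmod_pairing_le:
  "cmod (pairing n a (toeplitz_mat n t)) \<le> (\<Sum>k\<in>{- int n<..<int n}. cmod (a k)) * opnorm (toeplitz_mat n t)"
  unfolding pairing_toeplitz_mat sum_distrib_right
  by (rule order_trans[OF norm_sum])
     (auto simp: norm_mult intro!: sum_mono mult_left_mono cmod_le_opnorm_toeplitz)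

lemma cmod_pairing_le_dual_norm:
  assumes "A \<in> toeplitz_sa n" "opnorm A \<le> 1"
  shows "cmod (pairing n a A) \<le> dual_norm n a"
  unfolding dual_norm_def
proof (rule cSUP_upper)
  show "bdd_above ((\<lambda>A. cmod (pairing n a A)) ` {A \<in> toeplitz_sa n. opnorm A \<le> 1})"
  proof (rule bdd_aboveI2)
    fix B assume B: "B \<in> {A \<in> toeplitz_sa n. opnorm A \<le> 1}"
    then obtain t where t: "B = toeplitz_mat n t" by (auto elim: toeplitz_saE)
    show "cmod (pairing n a B) \<le> (\<Sum>k\<in>{- int n<..<int n}. cmod (a k))"
      using B unfolding t
      by (intro order_trans[OF cmod_pairing_le] mult_left_le sum_nonneg) auto
  qed
qed (use assms in auto)

lemma dual_norm_nonneg: "0 \<le> dual_norm n a"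
  by (rule order_trans[OF _ cmod_pairing_le_dual_norm[OF zero_in_toeplitz_sa]]) auto

lemma dual_norm_least:
  assumes "\<And>t. hermitian_seq t \<Longrightarrow> opnorm (toeplitz_mat n t) \<le> 1 \<Longrightarrow> cmod (pairing n a (toeplitz_mat n t)) \<le> c"
  shows "dual_norm n a \<le> c"
  unfolding dual_norm_def
proof (rule cSUP_least)
  show "{A \<in> toeplitz_sa n. opnorm A \<le> 1} \<noteq> {}"
    using zero_in_toeplitz_sa opnorm_zero by (metis (mono_tags, lifting) empty_iff mem_Collect_eq zero_le_one)
qed (use assms in \<open>auto elim!: toeplitz_saE\<close>)

lemma opnorm_Dirac_commutator:
  "opnorm (Dirac_commutator n (toeplitz_mat n t)) = opnorm (toeplitz_mat n (\<lambda>k. of_int k * t k))"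
proof -
  have "opnorm (derivation n (toeplitz_mat n t)) = opnorm (Dirac_commutator n (toeplitz_mat n t))"
    by (simp add: derivation_def opnorm_smult)
  moreover have "derivation n (toeplitz_mat n t) = \<i> \<cdot>\<^sub>m toeplitz_mat n (\<lambda>k. of_int k * t k)"
    unfolding derivation_toeplitz_mat toeplitz_mat_smult[symmetric] by (simp add: mult.assoc)
  ultimately show ?thesis by (simp add: opnorm_smult)
qed

text \<open>Conjugation amounts to the substitution of \<open>- k\<close> for \<open>k\<close> in
  the sum. Hence the modulus of such a pairing is the absolute value of its real part.\<close>

lemma pairing_real:
  assumes "hermitian_seq a" "hermitian_seq t"
  shows "pairing n a (toeplitz_mat n t) \<in> \<real>"
proof -
  have "cnj (pairing n a (toeplitz_mat n t)) = (\<Sum>k\<in>{- int n<..<int n}. a (- k) * t k)"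
    using assms unfolding pairing_toeplitz_mat hermitian_seq_def
    by simp
  also have "\<dots> = (\<Sum>k\<in>{- int n<..<int n}. a k * t (- k))"
    by (rule sum.reindex_bij_witness[of _ uminus uminus]) auto
  finally show ?thesis
    by (simp add: pairing_toeplitz_mat Reals_cnj_iff)
qed

subsection \<open>The distance as an infimum over constants\<close>

text \<open>The choice of the free value in a one-dimensional Hahn-Banach extension: every lower
  bound \<open>l x\<close> lies below every upper bound \<open>u y\<close>, and the supremum of the
  lower bounds separates them.\<close>

lemma ex_separating_real:
  fixes l u :: "'a \<Rightarrow> real"
  assumes "\<And>x y. x \<in> H \<Longrightarrow> y \<in> H \<Longrightarrow> l x \<le> u y" "H \<noteq> {}"
  shows "\<exists>c. \<forall>x\<in>H. l x \<le> c \<and> c \<le> u x"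
proof (intro exI[of _ "SUP x\<in>H. l x"] ballI conjI)
  fix x assume x: "x \<in> H"
  have "bdd_above (l ` H)" using assms(1) x by (auto intro!: bdd_aboveI2)
  then show "l x \<le> (SUP x\<in>H. l x)" using x by (rule cSUP_upper2) auto
  show "(SUP x\<in>H. l x) \<le> u x" using assms x by (intro cSUP_least) auto
qed


lemma pairing_diff_fun: "pairing n (a - b) A = pairing n a A - pairing n b A"
  by (simp add: pairing_def left_diff_distrib sum_subtractf)

lemma pairing_const_seq:
  assumes "n > 0"
  shows "pairing n (const_seq c) (toeplitz_mat n t) = of_real c * t 0"
proof -
  have "pairing n (const_seq c) (toeplitz_mat n t)
      = (\<Sum>k\<in>{- int n<..<int n}. if k = 0 then of_real c * t 0 else 0)"
    unfolding pairing_toeplitz_mat by (intro sum.cong) (auto simp: const_seq_def)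
  then show ?thesis using assms by simp
qed

lemma pairing_toeplitz_diff:
  "pairing n a (toeplitz_mat n (\<lambda>k. t k - u k)) = pairing n a (toeplitz_mat n t) - pairing n a (toeplitz_mat n u)"
  by (simp add: pairing_toeplitz_mat right_diff_distrib sum_subtractf)

lemma pairing_toeplitz_smult:
  "pairing n a (toeplitz_mat n (\<lambda>k. c * t k)) = c * pairing n a (toeplitz_mat n t)"
  by (simp add: pairing_toeplitz_mat sum_distrib_left mult_ac)

text \<open>The two primitive equations are subtracted, which cancels \<open>const_seq r\<close>,
  and the factor \<open>k\<close> is moved from the functional to the matrix. The matrix so obtained
  has zero diagonal, hence any \<open>const_seq c\<close> may be inserted.\<close>

lemma pairing_diff_eq_pairing_primitive:
  assumes "n > 0" and \<Phi>: "is_primitive n \<Phi> (\<phi> - const_seq r)" and \<Psi>: "is_primitive n \<Psi> (\<psi> - const_seq r)"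
  shows "pairing n \<phi> (toeplitz_mat n t) - pairing n \<psi> (toeplitz_mat n t)
       = pairing n (\<Psi> - \<Phi> - const_seq c) (toeplitz_mat n (\<lambda>k. - \<i> * of_int k * t k))"
proof -
  have "\<phi> k - \<psi> k = \<i> * of_int k * (\<Psi> k - \<Phi> k)" for k
  proof -
    have "\<phi> k - const_seq r k = - \<i> * of_int k * \<Phi> k" "\<psi> k - const_seq r k = - \<i> * of_int k * \<Psi> k"
      using assms(2,3) by (auto simp: is_primitive_def derivation_transpose_eq fun_eq_iff)
    then have "(\<phi> k - const_seq r k) - (\<psi> k - const_seq r k) = \<i> * of_int k * (\<Psi> k - \<Phi> k)"
      by (simp only: right_diff_distrib) simp
    then show ?thesis by simp
  qed
  then have "pairing n (\<phi> - \<psi>) (toeplitz_mat n t)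
      = pairing n (\<Psi> - \<Phi>) (toeplitz_mat n (\<lambda>k. - \<i> * of_int k * t k))"
    unfolding pairing_toeplitz_mat by (simp add: mult_ac)
  then show ?thesis
    by (simp add: pairing_diff_fun pairing_const_seq[OF assms(1)])
qed

text \<open>Each constant gives an upper bound for the distance \<open>S\<close>, because
  derivatives of admissible matrices are contractions with zero diagonal. Conversely, the functional
  of \<open>a\<close>, bounded by \<open>S\<close> on zero-diagonal matrices, is corrected by a
  suitable multiple of the diagonal entry so that the bound holds everywhere. The infimum is
  therefore attained.\<close>

lemma state_dist_eq_INF_dual_norm:
  assumes n: "n > 0"
    and \<Phi>: "is_primitive n \<Phi> (\<phi> - const_seq r)" and \<Psi>: "is_primitive n \<Psi> (\<psi> - const_seq r)"
  shows "state_dist n \<phi> \<psi> = (INF c :: real. dual_norm n (\<Psi> - \<Phi> - const_seq c))"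
proof -
  define a where "a = \<Psi> - \<Phi>"
  define S where "S = state_dist n \<phi> \<psi>"
  define D where "D = {A \<in> toeplitz_sa n. opnorm (Dirac_commutator n A) \<le> 1}"
  define P where "P t = opnorm (toeplitz_mat n t)" for t
  define f where "f t = Re (pairing n a (toeplitz_mat n t))" for t
  have a: "hermitian_seq a" "hermitian_seq (a - const_seq c)" for c
    using \<Phi> \<Psi> by (auto simp: a_def is_primitive_def dual_seq_sa_def hermitian_seq_def const_seq_def)
  have D_le: "cmod (pairing n \<phi> A - pairing n \<psi> A) \<le> dual_norm n (a - const_seq c)" if "A \<in> D" for A c
  proof -
    from that have "A \<in> toeplitz_sa n" by (simp add: D_def)
    then obtain t where t: "hermitian_seq t" "A = toeplitz_mat n t" by (rule toeplitz_saE)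
    let ?h = "\<lambda>k. - \<i> * of_int k * t k"
    have "hermitian_seq ?h"
      using t(1) by (simp add: hermitian_seq_def)
    moreover have "opnorm (toeplitz_mat n ?h) \<le> 1"
      using that opnorm_smult[of "- \<i>" "toeplitz_mat n (\<lambda>k. of_int k * t k)"]
      by (simp add: D_def t(2) opnorm_Dirac_commutator flip: toeplitz_mat_smult)
         (simp add: mult.assoc)
    ultimately show ?thesis
      unfolding t(2) pairing_diff_eq_pairing_primitive[OF assms, of t c]
      by (simp add: a_def cmod_pairing_le_dual_norm toeplitz_mat_hermitian)
  qed
  have "toeplitz_mat n (\<lambda>k. 0) \<in> D"
    using opnorm_Dirac_commutator[of n "\<lambda>k. 0"] zero_in_toeplitz_sa by (simp add: D_def)
  then have "D \<noteq> {}" by blast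
  have S_eq: "S = (SUP A\<in>D. cmod (pairing n \<phi> A - pairing n \<psi> A))"
    by (simp add: S_def state_dist_def D_def)
  have S_le: "S \<le> dual_norm n (a - const_seq c)" for c
    unfolding S_eq using \<open>D \<noteq> {}\<close> D_le by (rule cSUP_least)
  have S_upper: "cmod (pairing n \<phi> A - pairing n \<psi> A) \<le> S" if "A \<in> D" for A
    unfolding S_eq using that by (rule cSUP_upper) (use D_le in \<open>auto intro!: bdd_aboveI2\<close>)
  have S_nonneg: "0 \<le> S"
    using S_upper \<open>D \<noteq> {}\<close> norm_ge_zero order_trans by blast
  have f_diff: "f (\<lambda>k. t k - u k) = f t - f u" for t u
    by (simp add: f_def pairing_toeplitz_diff)
  have f_smult: "f (\<lambda>k. of_real s * t k) = s * f t" for s t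
    by (simp add: f_def pairing_toeplitz_smult)
  have P_smult: "P (\<lambda>k. of_real s * t k) = \<bar>s\<bar> * P t" for s t
    by (simp add: P_def toeplitz_mat_smult opnorm_smult)
  have P_diff: "P (\<lambda>k. t k - u k) \<le> P t + P u" for t u
    unfolding P_def toeplitz_mat_diff by (rule opnorm_triangle_diff) auto
  \<comment> \<open>A hermitian sequence vanishing at 0 is a derivative, so \<open>S\<close> bounds \<open>f\<close> on it.\<close>
  have f_le: "\<bar>f h\<bar> \<le> S * P h" if h: "hermitian_seq h" "h 0 = 0" for h
  proof (cases "P h = 0")
    case True
    \<comment> \<open>Normalising by \<open>P h\<close> is impossible here, but the pairing is at
      most a multiple of \<open>P h\<close> and so vanishes.\<close>
    have "\<bar>f h\<bar> \<le> cmod (pairing n a (toeplitz_mat n h))"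
      unfolding f_def by (rule abs_Re_le_cmod)
    then show ?thesis using cmod_pairing_le[of n a h] True by (simp add: P_def)
  next
    case False
    then have "P h > 0" by (simp add: P_def less_le)
    \<comment> \<open>The antiderivative of \<open>h\<close>, scaled so that its commutator with the
      Dirac operator has norm 1. At \<open>k = 0\<close> division by zero gives 0, which is
      consistent because \<open>h 0 = 0\<close>.\<close>
    define t where "t k = \<i> * h k / (of_int k * of_real (P h))" for k
    have herm: "hermitian_seq t"
      using h by (simp add: hermitian_seq_def t_def)
    have "(\<lambda>k. of_int k * t k) = (\<lambda>k. \<i> / of_real (P h) * h k)"
      using h by (auto simp: t_def fun_eq_iff)
    then have "opnorm (toeplitz_mat n (\<lambda>k. of_int k * t k)) = cmod (\<i> / of_real (P h)) * P h"
      by (simp only: toeplitz_mat_smult opnorm_smult P_def)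
    also have "\<dots> = 1" using \<open>P h > 0\<close> by (simp add: norm_divide)
    finally have "opnorm (toeplitz_mat n (\<lambda>k. of_int k * t k)) = 1" .
    then have "toeplitz_mat n t \<in> D"
      using herm by (simp add: D_def opnorm_Dirac_commutator toeplitz_mat_hermitian)
    then have "cmod (pairing n \<phi> (toeplitz_mat n t) - pairing n \<psi> (toeplitz_mat n t)) \<le> S"
      by (rule S_upper)
    moreover have "(\<lambda>k. - \<i> * of_int k * t k) = (\<lambda>k. of_real (1 / P h) * h k)"
      using h by (auto simp: t_def fun_eq_iff)
    ultimately have "cmod (pairing n a (toeplitz_mat n (\<lambda>k. of_real (1 / P h) * h k))) \<le> S"
      unfolding pairing_diff_eq_pairing_primitive[OF assms, of t 0]
      by (simp add: a_def pairing_diff_fun pairing_const_seq[OF n])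
    then have "\<bar>f (\<lambda>k. of_real (1 / P h) * h k)\<bar> \<le> S"
      unfolding f_def using abs_Re_le_cmod order_trans by blast
    then show ?thesis
      using \<open>P h > 0\<close> unfolding f_smult by (simp add: abs_mult field_simps)
  qed
  \<comment> \<open>The extension step, on the affine hyperplane \<open>t 0 = 1\<close>, whose differences vanish at 0.\<close>
  define H where "H = {t. hermitian_seq t \<and> t 0 = 1}"
  have "const_seq 1 \<in> H" by (simp add: H_def const_seq_def hermitian_seq_def)
  have "f x - S * P x \<le> f y + S * P y" if "x \<in> H" "y \<in> H" for x y
  proof -
    have "\<bar>f (\<lambda>k. x k - y k)\<bar> \<le> S * P (\<lambda>k. x k - y k)"
      using that by (intro f_le) (auto simp: H_def hermitian_seq_def)
    also have "\<dots> \<le> S * (P x + P y)"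
      by (intro mult_left_mono P_diff S_nonneg)
    finally show ?thesis by (simp add: f_diff algebra_simps)
  qed
  \<comment> \<open>The two bounds together say that \<open>f x - c\<close>, the value of
    \<open>a - const_seq c\<close> at \<open>x\<close>, is at most \<open>S * P x\<close> in
    absolute value on \<open>H\<close>.\<close>
  then obtain c where c: "\<forall>x\<in>H. f x - S * P x \<le> c \<and> c \<le> f x + S * P x"
    using ex_separating_real[of H "\<lambda>x. f x - S * P x" "\<lambda>x. f x + S * P x"] \<open>const_seq 1 \<in> H\<close> by blast
  have "dual_norm n (a - const_seq c) \<le> S"
  proof (rule dual_norm_least)
    fix t assume t: "hermitian_seq t" "opnorm (toeplitz_mat n t) \<le> 1"
    obtain s where s: "t 0 = of_real s"
      using t(1) Reals_cnj_iff[of "t 0"] by (metis Reals_cases hermitian_seq_def minus_zero)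
    have "pairing n (a - const_seq c) (toeplitz_mat n t) = of_real (f t - c * s)"
      using pairing_real[OF a(1) t(1), of n] s
      by (simp add: pairing_diff_fun pairing_const_seq[OF n] f_def of_real_Re)
    then have eq: "cmod (pairing n (a - const_seq c) (toeplitz_mat n t)) = \<bar>f t - c * s\<bar>"
      by (simp only: norm_of_real)
    \<comment> \<open>By homogeneity: with zero diagonal \<open>f_le\<close> applies directly, and
      otherwise division by the diagonal entry \<open>s\<close> moves \<open>t\<close> into
      \<open>H\<close>.\<close>
    have "\<bar>f t - c * s\<bar> \<le> S * P t"
    proof (cases "s = 0")
      case True
      then show ?thesis using f_le[OF t(1)] s by simp
    next
      case False
      let ?h = "\<lambda>k. of_real (1 / s) * t k"
      have "?h \<in> H" using False t(1) s by (auto simp: H_def hermitian_seq_def)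
      then have "\<bar>f ?h - c\<bar> \<le> S * P ?h"
        using c by (auto simp: abs_le_iff)
      then have "\<bar>s\<bar> * \<bar>f t / s - c\<bar> \<le> \<bar>s\<bar> * (S * (P t / \<bar>s\<bar>))"
        unfolding f_smult P_smult by (intro mult_left_mono) auto
      then show ?thesis
        using False by (simp add: abs_mult[symmetric] right_diff_distrib mult.commute)
    qed
    also have "\<dots> \<le> S"
      using S_nonneg t(2) by (simp add: P_def mult_left_le)
    finally show "cmod (pairing n (a - const_seq c) (toeplitz_mat n t)) \<le> S"
      using eq by simp
  qed
  then have "dual_norm n (a - const_seq c) = S" using S_le by (rule antisym)
  then have "S = (INF c. dual_norm n (a - const_seq c))"
    using S_le by (intro cInf_eq_minimum[symmetric]) auto
  then show ?thesis by (simp add: S_def a_def)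
qed

lemma symbol_cis: "symbol n a (cis x) = (\<Sum>k\<in>{- int n<..<int n}. a k * cis (of_int k * x))"
  by (simp add: symbol_def cis_power_int)

subsection \<open>Toeplitz matrices of bounded functions\<close>

abbreviation period :: "real measure" where
  "period \<equiv> restrict_space lborel {0..<2*pi}"

lemma finite_measure_period: "finite_measure period"
  by (rule finite_measureI) (simp add: space_restrict_space emeasure_restrict_space)

lemma integrable_period:
  fixes f :: "real \<Rightarrow> 'a::{banach, second_countable_topology}"
  assumes "f \<in> borel_measurable borel" "\<And>x. norm (f x) \<le> B"
  shows "integrable period f"
proof -
  interpret finite_measure period by (rule finite_measure_period)
  have "f \<in> borel_measurable period"
    using assms(1) by (intro measurable_restrict_space1) simp
  then show ?thesis
    using assms(2) by (intro integrable_const_bound[where B = B]) auto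
qed

lemma measurable_cis [measurable]: "cis \<in> borel_measurable borel"
  by (intro borel_measurable_continuous_onI continuous_intros)

text \<open>Orthogonality of the characters, from the antiderivative \<open>G\<close>, which takes
  equal values at 0 and 2 pi unless \<open>m = 0\<close>.\<close>

lemma integral_period_cis:
  "(\<integral>x. cis (of_int m * x) \<partial>period) = (if m = 0 then of_real (2 * pi) else 0)"
proof -
  define G where "G x = (if m = 0 then of_real x else cis (of_int m * x) / (\<i> * of_int m))" for x
  have G: "(G has_vector_derivative cis (of_int m * x)) (at x within {0..2*pi})" for x
  proof (cases "m = 0")
    case True
    have "((\<lambda>x. of_real x :: complex) has_vector_derivative of_real 1) (at x within {0..2*pi})"
      by (intro has_vector_derivative_of_real DERIV_ident)
    then show ?thesis unfolding G_def using True by simp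
  next
    case False
    have "((\<lambda>z. exp (\<i> * of_int m * z) / (\<i> * of_int m)) has_field_derivative exp (\<i> * of_int m * of_real x))
        (at (of_real x))"
      using False by (auto intro!: derivative_eq_intros)
    then have "((\<lambda>x. exp (\<i> * of_int m * of_real x) / (\<i> * of_int m)) has_vector_derivative
        exp (\<i> * of_int m * of_real x)) (at x within {0..2*pi})"
      by (rule has_vector_derivative_real_field)
    then show ?thesis unfolding G_def using False by (simp add: cis_conv_exp mult.assoc)
  qed
  have "(\<integral>x. cis (of_int m * x) \<partial>period) = (\<integral>x. indicator {0..<2*pi} x *\<^sub>R cis (of_int m * x) \<partial>lborel)"
    by (subst integral_restrict_space) auto
  \<comment> \<open>The fundamental theorem is stated for closed intervals; the added endpoint is a
    null set.\<close>
  also have "\<dots> = (\<integral>x. indicator {0..2*pi} x *\<^sub>R cis (of_int m * x) \<partial>lborel)"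
    using AE_lborel_singleton[of "2*pi"]
    by (intro integral_cong_AE) (auto elim!: eventually_mono split: split_indicator)
  also have "\<dots> = G (2 * pi) - G 0"
    using G by (intro integral_FTC_Icc) (auto intro!: continuous_intros)
  also have "\<dots> = (if m = 0 then of_real (2 * pi) else 0)"
    using cis_multiple_2pi[of "of_int m"] by (simp add: G_def mult_ac)
  finally show ?thesis .
qed

definition fourier_coeff :: "(real \<Rightarrow> complex) \<Rightarrow> int \<Rightarrow> complex" where
  "fourier_coeff u m = (\<integral>x. u x * cis (- of_int m * x) \<partial>period) / of_real (2 * pi)"

text \<open>The embedding of vectors into functions on the circle, isometric up to the factor 2 pi
  in the squared norm. Frequencies start at 0 to agree with the numbering of matrix rows.\<close>

definition trig_poly :: "complex vec \<Rightarrow> real \<Rightarrow> complex" where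
  "trig_poly v x = (\<Sum>l<dim_vec v. vec_index v l * cis (real l * x))"

lemma trig_poly_measurable [measurable]: "trig_poly v \<in> borel_measurable borel"
  unfolding trig_poly_def by measurable

lemma cmod_trig_poly_le: "cmod (trig_poly v x) \<le> (\<Sum>l<dim_vec v. cmod (vec_index v l))"
  unfolding trig_poly_def by (rule order_trans[OF norm_sum]) (simp add: norm_mult)

text \<open>The Toeplitz matrix of the Fourier coefficients of \<open>u\<close> is the compression
  of multiplication by \<open>u\<close> to trigonometric polynomials with frequencies 0 to n-1.
  Finite sums are exchanged with the integral.\<close>

lemma toeplitz_fourier_sesquilinear:
  assumes u: "u \<in> borel_measurable borel" "\<And>x. cmod (u x) \<le> B"
    and v: "v \<in> carrier_vec n" and w: "w \<in> carrier_vec n"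
  shows "(toeplitz_mat n (fourier_coeff u) *\<^sub>v v) \<bullet>c w
       = (\<integral>x. u x * (trig_poly v x * cnj (trig_poly w x)) \<partial>period) / of_real (2 * pi)"
proof -
  note [measurable] = u(1)
  let ?g = "\<lambda>k l x. u x * cis (- of_int (int k - int l) * x)"
  let ?c = "\<lambda>k l. vec_index v l * cnj (vec_index w k)"
  have int: "integrable period (?g k l)" for k l
    by (rule integrable_period[of _ B]) (auto simp: norm_mult u(2))
  have "(toeplitz_mat n (fourier_coeff u) *\<^sub>v v) \<bullet>c w
      = (\<Sum>k<n. \<Sum>l<n. fourier_coeff u (int k - int l) * ?c k l)"
    using v w by (simp add: toeplitz_mat_def scalar_prod_def lessThan_atLeast0 sum_distrib_left sum_distrib_right mult_ac)
  also have "\<dots> = (\<Sum>k<n. \<Sum>l<n. (\<integral>x. ?g k l x * ?c k l \<partial>period)) / of_real (2 * pi)"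
    by (simp add: fourier_coeff_def sum_divide_distrib)
  also have "(\<Sum>k<n. \<Sum>l<n. (\<integral>x. ?g k l x * ?c k l \<partial>period))
      = (\<Sum>k<n. (\<integral>x. (\<Sum>l<n. ?g k l x * ?c k l) \<partial>period))"
    by (intro sum.cong refl Bochner_Integration.integral_sum[symmetric] integrable_mult_left int)
  also have "\<dots> = (\<integral>x. (\<Sum>k<n. \<Sum>l<n. ?g k l x * ?c k l) \<partial>period)"
    by (intro Bochner_Integration.integral_sum[symmetric] Bochner_Integration.integrable_sum integrable_mult_left int)
  also have "(\<lambda>x. \<Sum>k<n. \<Sum>l<n. ?g k l x * ?c k l) = (\<lambda>x. u x * (trig_poly v x * cnj (trig_poly w x)))"
  proof
    fix x
    have cis: "cis (- of_int (int k - int l) * x) = cis (real l * x) * cnj (cis (real k * x))" for k l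
      by (simp add: cis_cnj cis_mult algebra_simps)
    show "(\<Sum>k<n. \<Sum>l<n. ?g k l x * ?c k l) = u x * (trig_poly v x * cnj (trig_poly w x))"
      using v w unfolding cis trig_poly_def
      by (simp add: sum_distrib_left sum_distrib_right mult_ac)
  qed
  finally show ?thesis .
qed

lemma fourier_coeff_1: "fourier_coeff (\<lambda>x. 1) m = (if m = 0 then 1 else 0)"
  using integral_period_cis[of "- m"] by (simp add: fourier_coeff_def)

text \<open>The case \<open>u = 1\<close> of the compression formula, where the Toeplitz matrix is
  the identity.\<close>

lemma parseval_trig_poly:
  "(\<integral>x. (cmod (trig_poly v x))\<^sup>2 \<partial>period) = 2 * pi * (l2norm v)\<^sup>2"
proof -
  define n where "n = dim_vec v"
  have v: "v \<in> carrier_vec n" by (simp add: n_def)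
  have "toeplitz_mat n (fourier_coeff (\<lambda>x. 1)) = 1\<^sub>m n"
    by (rule eq_matI) (auto simp: toeplitz_mat_def fourier_coeff_1)
  then have "v \<bullet>c v = (\<integral>x. trig_poly v x * cnj (trig_poly v x) \<partial>period) / of_real (2 * pi)"
    using toeplitz_fourier_sesquilinear[of "\<lambda>x. 1" 1, OF _ _ v v] v by simp
  also have "\<dots> = of_real ((\<integral>x. (cmod (trig_poly v x))\<^sup>2 \<partial>period) / (2 * pi))"
    by (simp flip: complex_norm_square of_real_power)
  finally have "Re (v \<bullet>c v) = (\<integral>x. (cmod (trig_poly v x))\<^sup>2 \<partial>period) / (2 * pi)"
    by simp
  then show ?thesis by (simp add: l2norm_power2)
qed

text \<open>A compression of a contraction is a contraction. For \<open>w = T v\<close> the squared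
  norm of \<open>w\<close> is an integral of \<open>u\<close> against the two polynomials. The bound
  \<open>x y \<le> (x^2 + y^2) / 2\<close> and Parseval estimate it by half the sum of the squared
  norms of \<open>v\<close> and \<open>w\<close>, and the part with \<open>w\<close> is absorbed on
  the left.\<close>

lemma opnorm_toeplitz_fourier_le_1:
  assumes u: "u \<in> borel_measurable borel" "\<And>x. cmod (u x) \<le> 1"
  shows "opnorm (toeplitz_mat n (fourier_coeff u)) \<le> 1"
proof (rule opnorm_least)
  note [measurable] = u(1)
  let ?T = "toeplitz_mat n (fourier_coeff u)"
  fix v assume v: "v \<in> carrier_vec (dim_col ?T)" "l2norm v \<le> 1"
  define w where "w = ?T *\<^sub>v v"
  have w: "w \<in> carrier_vec n" by (simp add: w_def carrier_vecI)
  have sq: "integrable period (\<lambda>x. (cmod (trig_poly y x))\<^sup>2)" for y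
    by (rule integrable_period[where B = "(\<Sum>l<dim_vec y. cmod (vec_index y l))\<^sup>2"])
       (auto intro!: power_mono cmod_trig_poly_le)
  have "(l2norm w)\<^sup>2 \<le> cmod (w \<bullet>c w)"
    unfolding l2norm_power2 by (rule complex_Re_le_cmod)
  also have "w \<bullet>c w = (\<integral>x. u x * (trig_poly v x * cnj (trig_poly w x)) \<partial>period) / of_real (2 * pi)"
    using v w u toeplitz_fourier_sesquilinear[of u 1 v n w] by (simp add: w_def)
  also have "cmod \<dots> \<le> (\<integral>x. ((cmod (trig_poly v x))\<^sup>2 + (cmod (trig_poly w x))\<^sup>2) / 2 \<partial>period) / (2 * pi)"
    unfolding norm_divide norm_of_real
  proof (intro divide_mono order_trans[OF integral_norm_bound] integral_mono_AE)
    show "AE x in period. cmod (u x * (trig_poly v x * cnj (trig_poly w x)))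
        \<le> ((cmod (trig_poly v x))\<^sup>2 + (cmod (trig_poly w x))\<^sup>2) / 2"
    proof (rule AE_I2)
      fix x
      have "cmod (u x * (trig_poly v x * cnj (trig_poly w x))) \<le> cmod (trig_poly v x) * cmod (trig_poly w x)"
        using mult_right_mono[OF u(2)[of x], of "cmod (trig_poly v x) * cmod (trig_poly w x)"]
        by (simp add: norm_mult)
      also have "\<dots> \<le> ((cmod (trig_poly v x))\<^sup>2 + (cmod (trig_poly w x))\<^sup>2) / 2"
        using sum_squares_bound[of "cmod (trig_poly v x)" "cmod (trig_poly w x)"] by simp
      finally show "cmod (u x * (trig_poly v x * cnj (trig_poly w x)))
        \<le> ((cmod (trig_poly v x))\<^sup>2 + (cmod (trig_poly w x))\<^sup>2) / 2" .
    qed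
    show "integrable period (\<lambda>x. cmod (u x * (trig_poly v x * cnj (trig_poly w x))))"
      unfolding norm_mult complex_mod_cnj
    proof (rule integrable_period)
      fix x
      have "cmod (u x) * (cmod (trig_poly v x) * cmod (trig_poly w x))
          \<le> 1 * ((\<Sum>l<dim_vec v. cmod (vec_index v l)) * (\<Sum>l<dim_vec w. cmod (vec_index w l)))"
        by (intro mult_mono cmod_trig_poly_le u mult_nonneg_nonneg sum_nonneg) auto
      then show "norm (cmod (u x) * (cmod (trig_poly v x) * cmod (trig_poly w x)))
          \<le> 1 * ((\<Sum>l<dim_vec v. cmod (vec_index v l)) * (\<Sum>l<dim_vec w. cmod (vec_index w l)))"
        by (simp add: norm_mult)
    qed measurable
  qed (auto intro!: sq)
  also have "\<dots> = ((\<integral>x. (cmod (trig_poly v x))\<^sup>2 \<partial>period) + (\<integral>x. (cmod (trig_poly w x))\<^sup>2 \<partial>period)) / 2 / (2 * pi)"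
    by (simp add: sq)
  also have "\<dots> = ((l2norm v)\<^sup>2 + (l2norm w)\<^sup>2) / 2"
    unfolding parseval_trig_poly by (simp add: field_simps)
  finally have "(l2norm w)\<^sup>2 \<le> (l2norm v)\<^sup>2" by simp
  then have "l2norm w \<le> l2norm v" by (rule power2_le_imp_le) simp
  then show "l2norm (?T *\<^sub>v v) \<le> 1" using v(2) by (simp add: w_def)
qed

section \<open>Symbols and the L1 lower bound for the dual norm\<close>

lemma symbol_cis_measurable [measurable]: "(\<lambda>x. symbol n a (cis x)) \<in> borel_measurable borel"
  unfolding symbol_cis by measurable

lemma symbol_real:
  assumes "hermitian_seq a"
  shows "symbol n a (cis x) = of_real (Re (symbol n a (cis x)))"
proof -
  have "cnj (symbol n a (cis x)) = (\<Sum>k\<in>{- int n<..<int n}. a (- k) * cis (of_int (- k) * x))"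
    using assms by (simp add: symbol_cis hermitian_seq_def cis_cnj)
  also have "\<dots> = symbol n a (cis x)"
    unfolding symbol_cis by (rule sum.reindex_bij_witness[of _ uminus uminus]) auto
  finally show ?thesis
    by (metis Reals_cnj_iff of_real_Re)
qed

text \<open>The pairing reads the coefficient at \<open>- k\<close>, which integrates
  \<open>u\<close> against \<open>cis (k x)\<close>. So the symbol appears without
  conjugation.\<close>

lemma pairing_fourier_coeff:
  assumes u: "u \<in> borel_measurable borel" "\<And>x. cmod (u x) \<le> B"
  shows "pairing n a (toeplitz_mat n (fourier_coeff u))
       = (\<integral>x. u x * symbol n a (cis x) \<partial>period) / of_real (2 * pi)"
proof -
  note [measurable] = u(1)
  have int: "integrable period (\<lambda>x. u x * cis (of_int k * x))" for k
    by (rule integrable_period[of _ B]) (auto simp: norm_mult u(2))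
  have "pairing n a (toeplitz_mat n (fourier_coeff u))
      = (\<Sum>k\<in>{- int n<..<int n}. (\<integral>x. a k * (u x * cis (of_int k * x)) \<partial>period)) / of_real (2 * pi)"
    by (simp add: pairing_toeplitz_mat fourier_coeff_def sum_divide_distrib)
  also have "(\<Sum>k\<in>{- int n<..<int n}. (\<integral>x. a k * (u x * cis (of_int k * x)) \<partial>period))
      = (\<integral>x. (\<Sum>k\<in>{- int n<..<int n}. a k * (u x * cis (of_int k * x))) \<partial>period)"
    by (subst Bochner_Integration.integral_sum) (auto intro!: integrable_mult_right int)
  also have "(\<lambda>x. \<Sum>k\<in>{- int n<..<int n}. a k * (u x * cis (of_int k * x))) = (\<lambda>x. u x * symbol n a (cis x))"
    by (simp add: symbol_cis sum_distrib_left mult_ac)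
  finally show ?thesis .
qed

lemma integral_symbol_le_dual_norm:
  assumes a: "hermitian_seq a"
  shows "(\<integral>x. \<bar>Re (symbol n a (cis x))\<bar> \<partial>period) \<le> 2 * pi * dual_norm n a"
proof -
  define u :: "real \<Rightarrow> complex" where "u x = of_real (sgn (Re (symbol n a (cis x))))" for x
  have u_meas: "u \<in> borel_measurable borel" unfolding u_def by measurable
  have u_le: "cmod (u x) \<le> 1" for x by (simp add: u_def sgn_if)
  \<comment> \<open>\<open>u\<close> is real valued, so its Fourier coefficients are Hermitian and
    the test matrix is self-adjoint.\<close>
  have "fourier_coeff u (- k) = cnj (fourier_coeff u k)" for k
  proof -
    have "cnj (fourier_coeff u k) = (\<integral>x. cnj (u x * cis (- of_int k * x)) \<partial>period) / of_real (2 * pi)"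
      unfolding fourier_coeff_def by (simp only: Bochner_Integration.integral_cnj complex_cnj_divide complex_cnj_complex_of_real)
    then show ?thesis by (simp add: fourier_coeff_def u_def cis_cnj)
  qed
  then have T: "toeplitz_mat n (fourier_coeff u) \<in> toeplitz_sa n"
    by (rule toeplitz_mat_sa)
  have "(\<lambda>x. u x * symbol n a (cis x)) = (\<lambda>x. of_real \<bar>Re (symbol n a (cis x))\<bar>)"
    by (subst symbol_real[OF a]) (auto simp: u_def fun_eq_iff abs_sgn mult.commute simp flip: of_real_mult)
  then have "pairing n a (toeplitz_mat n (fourier_coeff u))
      = of_real ((\<integral>x. \<bar>Re (symbol n a (cis x))\<bar> \<partial>period) / (2 * pi))"
    unfolding pairing_fourier_coeff[OF u_meas u_le] by simp
  then have "(\<integral>x. \<bar>Re (symbol n a (cis x))\<bar> \<partial>period) / (2 * pi) \<le> cmod (pairing n a (toeplitz_mat n (fourier_coeff u)))"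
    by (simp only: norm_of_real abs_ge_self)
  also have "\<dots> \<le> dual_norm n a"
    by (intro cmod_pairing_le_dual_norm T opnorm_toeplitz_fourier_le_1 u_meas u_le)
  finally show ?thesis by (simp add: field_simps)
qed

lemma cis_add_2pi: "cis (x + 2 * pi) = cis x"
  by (simp flip: cis_mult)

text \<open>The shifted interval is cut at 2 pi, and the part beyond is translated back by one
  period to fill the gap from 0 to \<open>x0\<close>.\<close>

lemma nn_integral_period_shift:
  assumes g [measurable]: "g \<in> borel_measurable borel"
    and per: "\<And>x. g (x + 2 * pi) = g x" and x0: "0 \<le> x0" "x0 \<le> 2 * pi"
  shows "(\<integral>\<^sup>+x. g x * indicator {x0..x0 + 2 * pi} x \<partial>lborel) = (\<integral>\<^sup>+x. g x \<partial>period)"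
proof -
  have "(\<integral>\<^sup>+x. g x * indicator {2 * pi..<x0 + 2 * pi} x \<partial>lborel)
      = (\<integral>\<^sup>+x. g (2 * pi + 1 * x) * indicator {2 * pi..<x0 + 2 * pi} (2 * pi + 1 * x) \<partial>lborel)"
    by (subst nn_integral_real_affine[where c = 1 and t = "2 * pi"]) auto
  also have "\<dots> = (\<integral>\<^sup>+x. g x * indicator {0..<x0} x \<partial>lborel)"
    using per by (intro nn_integral_cong) (auto simp: add.commute split: split_indicator)
  finally have shift: "(\<integral>\<^sup>+x. g x * indicator {2 * pi..<x0 + 2 * pi} x \<partial>lborel)
      = (\<integral>\<^sup>+x. g x * indicator {0..<x0} x \<partial>lborel)" .
  have "(\<integral>\<^sup>+x. g x * indicator {x0..x0 + 2 * pi} x \<partial>lborel)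
      = (\<integral>\<^sup>+x. g x * indicator {x0..<2 * pi} x + g x * indicator {2 * pi..<x0 + 2 * pi} x \<partial>lborel)"
    using AE_lborel_singleton[of "x0 + 2 * pi"] x0
    by (intro nn_integral_cong_AE) (auto elim!: eventually_mono split: split_indicator)
  also have "\<dots> = (\<integral>\<^sup>+x. g x * indicator {x0..<2 * pi} x \<partial>lborel) + (\<integral>\<^sup>+x. g x * indicator {0..<x0} x \<partial>lborel)"
    by (subst nn_integral_add) (auto simp: shift)
  also have "\<dots> = (\<integral>\<^sup>+x. g x * indicator {x0..<2 * pi} x + g x * indicator {0..<x0} x \<partial>lborel)"
    by (subst nn_integral_add) auto
  also have "\<dots> = (\<integral>\<^sup>+x. g x * indicator {0..<2 * pi} x \<partial>lborel)"
    using x0 by (intro nn_integral_cong) (auto split: split_indicator)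
  also have "\<dots> = (\<integral>\<^sup>+x. g x \<partial>period)"
    by (simp add: nn_integral_restrict_space)
  finally show ?thesis .
qed

subsection \<open>Quantile coupling on the circle\<close>

text \<open>\<open>P\<close> is the inverse of \<open>F\<close> on the interval, with its argument
  clamped to the range of \<open>F\<close>. The clamping makes \<open>P\<close> continuous on the
  whole line, hence Borel measurable.\<close>

lemma continuous_quantile:
  fixes F :: "real \<Rightarrow> real"
  assumes cont: "continuous_on {a..b} F" and mono: "strict_mono F" and ab: "a \<le> b"
  obtains P where "continuous_on UNIV P" "\<And>x. x \<in> {a..b} \<Longrightarrow> P (F x) = x"
    "\<And>t. t \<in> {F a..F b} \<Longrightarrow> P t \<in> {a..b} \<and> F (P t) = t"
proof -
  have inj: "inj_on F {a..b}"
    using mono strict_mono_imp_inj_on by blast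
  define R where "R = the_inv_into {a..b} F"
  have R: "R (F x) = x" if "x \<in> {a..b}" for x
    unfolding R_def using inj that by (rule the_inv_into_f_f)
  have img: "F ` {a..b} = {F a..F b}"
  proof (intro equalityI subsetI)
    fix y assume "y \<in> {F a..F b}"
    then show "y \<in> F ` {a..b}" using IVT'[of F a y b] ab cont by auto
  qed (auto simp: strict_mono_less_eq[OF mono])
  have Rc: "continuous_on {F a..F b} R"
    using continuous_on_inv[OF cont, of R] R by (simp add: img)
  have Fab: "F a \<le> F b" using ab by (simp add: strict_mono_less_eq[OF mono])
  show ?thesis
  proof (rule that[of "\<lambda>t. R (max (F a) (min (F b) t))"])
    show "continuous_on UNIV (\<lambda>t. R (max (F a) (min (F b) t)))"
      using Fab by (intro continuous_on_compose2[OF Rc] continuous_intros) auto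
    fix x assume "x \<in> {a..b}"
    then have "max (F a) (min (F b) (F x)) = F x"
      using strict_mono_less_eq[OF mono] by auto
    then show "R (max (F a) (min (F b) (F x))) = x"
      using R[OF \<open>x \<in> {a..b}\<close>] by simp
  next
    fix t assume t: "t \<in> {F a..F b}"
    then obtain x where "x \<in> {a..b}" "t = F x" unfolding img[symmetric] by blast
    then show "R (max (F a) (min (F b) t)) \<in> {a..b} \<and> F (R (max (F a) (min (F b) t))) = t"
      using t R by auto
  qed
qed

lemma nn_integral_abs_diff_quantiles:
  fixes F G P Q :: "real \<Rightarrow> real"
  assumes mono: "strict_mono F" "strict_mono G" and ab: "a \<le> b"
    and ends: "F a = 0" "G a = 0" "F b = 1" "G b = 1"
    and meas [measurable]: "P \<in> borel_measurable borel" "Q \<in> borel_measurable borel"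
    and P: "\<And>t. t \<in> {0..1} \<Longrightarrow> P t \<in> {a..b} \<and> F (P t) = t"
    and Q: "\<And>t. t \<in> {0..1} \<Longrightarrow> Q t \<in> {a..b} \<and> G (Q t) = t"
  shows "(\<integral>\<^sup>+t. ennreal \<bar>P t - Q t\<bar> * indicator {0..1} t \<partial>lborel)
       = (\<integral>\<^sup>+y. ennreal \<bar>F y - G y\<bar> * indicator {a..b} y \<partial>lborel)"
proof -
  \<comment> \<open>Both sides are the area between the graphs of \<open>F\<close> and \<open>G\<close>.\<close>
  define k :: "real \<Rightarrow> real \<Rightarrow> ennreal" where
    "k t y = indicator {(t, y). (t \<in> {0..1} \<and> y \<in> {a..b}) \<and> (P t \<le> y \<and> y < Q t \<or> Q t \<le> y \<and> y < P t)} (t, y)" for t y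
  have [measurable]: "case_prod k \<in> borel_measurable (lborel \<Otimes>\<^sub>M lborel)"
    unfolding k_def by measurable
  have "(\<integral>\<^sup>+t. ennreal \<bar>P t - Q t\<bar> * indicator {0..1} t \<partial>lborel) = (\<integral>\<^sup>+t. (\<integral>\<^sup>+y. k t y \<partial>lborel) \<partial>lborel)"
  proof (rule nn_integral_cong)
    fix t
    show "ennreal \<bar>P t - Q t\<bar> * indicator {0..1} t = (\<integral>\<^sup>+y. k t y \<partial>lborel)"
    proof (cases "t \<in> {0..1}")
      case True
      then have "k t y = indicator {min (P t) (Q t)..<max (P t) (Q t)} y" for y
        using P[OF True] Q[OF True] by (auto simp: k_def split: split_indicator)
      then show ?thesis using True
        by (auto simp: max_def min_def abs_if)
    next
      case False
      then have "k t y = 0" for y by (auto simp: k_def)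
      then show ?thesis using False by simp
    qed
  qed
  also have "\<dots> = (\<integral>\<^sup>+y. (\<integral>\<^sup>+t. k t y \<partial>lborel) \<partial>lborel)"
    by (rule lborel_pair.Fubini'[symmetric]) measurable
  also have "\<dots> = (\<integral>\<^sup>+y. ennreal \<bar>F y - G y\<bar> * indicator {a..b} y \<partial>lborel)"
  proof (rule nn_integral_cong)
    fix y
    show "(\<integral>\<^sup>+t. k t y \<partial>lborel) = ennreal \<bar>F y - G y\<bar> * indicator {a..b} y"
    proof (cases "y \<in> {a..b}")
      case True
      have range: "F y \<in> {0..1}" "G y \<in> {0..1}"
        using True ends strict_mono_less_eq[OF mono(1)] strict_mono_less_eq[OF mono(2)]
        by (metis atLeastAtMost_iff)+
      \<comment> \<open>The defining equivalence of quantiles. It turns the section of the region at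
        height \<open>y\<close> into a half-open interval between \<open>F y\<close> and
        \<open>G y\<close>, whose length is the integrand on the right.\<close>
      have "P t \<le> y \<longleftrightarrow> t \<le> F y" "Q t \<le> y \<longleftrightarrow> t \<le> G y" if "t \<in> {0..1}" for t
        using P[OF that] Q[OF that] strict_mono_less_eq[OF mono(1), of "P t" y] strict_mono_less_eq[OF mono(2), of "Q t" y]
        by simp_all
      then have "k t y = indicator {min (F y) (G y)<..max (F y) (G y)} t" for t
        using True range by (auto simp: k_def not_le[symmetric] split: split_indicator)
      then show ?thesis using True
        by (auto simp: max_def min_def abs_if)
    next
      case False
      then have "k t y = 0" for t by (auto simp: k_def)
      then show ?thesis using False by simp
    qed
  qed
  finally show ?thesis .
qed

section \<open>Geodesic distance and image measures on the circle\<close>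

lemma geodesic_dist_cis_le: "geodesic_dist (cis x) (cis y) \<le> \<bar>x - y\<bar>"
proof -
  have eq: "cis x / cis y = cis (x - y)" by (simp add: cis_divide)
  show ?thesis
  proof (cases "x - y \<in> {- pi<..pi}")
    case True
    then show ?thesis by (simp add: geodesic_dist_def eq Arg_cis)
  next
    \<comment> \<open>Here the difference of the angles is at least pi in absolute value, and no
      principal argument exceeds pi.\<close>
    case False
    then show ?thesis
      using Arg_bounded[of "cis (x - y)"] by (auto simp: geodesic_dist_def eq)
  qed
qed

text \<open>\<open>Arg\<close> is continuous off the closed ray of nonpositive reals. On the ray it
  is pi, except for the default value 0 at the origin.\<close>

lemma measurable_Arg [measurable]: "Arg \<in> borel_measurable borel"
proof -
  have "Arg z = (if z \<in> \<real>\<^sub>\<le>\<^sub>0 then if z = 0 then 0 else pi else Arg z)" for z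
    by (auto elim!: nonpos_Reals_cases simp: Arg_of_real Arg_zero split: if_splits)
  moreover have "(\<lambda>z. if z \<in> \<real>\<^sub>\<le>\<^sub>0 then if z = (0::complex) then 0 else pi else Arg z) \<in> borel_measurable borel"
  proof (subst measurable_If_restrict_space_iff, goal_cases)
    case 1
    then show ?case using borel_closed[OF closed_nonpos_Reals_complex] by simp
  next
    case 2
    have "continuous_on {z. z \<notin> \<real>\<^sub>\<le>\<^sub>0} Arg"
      using continuous_on_Arg by (simp add: Compl_eq)
    then show ?case
      by (intro conjI measurable_restrict_space1 borel_measurable_continuous_on_restrict) auto
  qed
  ultimately show ?thesis by simp
qed

lemma measurable_cis_circle: "cis \<in> measurable borel circle_space"
  unfolding circle_space_def by (intro measurable_restrict_space2) auto

lemma measurable_circle_borel: "(\<lambda>z. z) \<in> measurable circle_space borel"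
  unfolding circle_space_def by (intro measurable_restrict_space1) simp

text \<open>The substitution \<open>t = F x\<close> turns the uniform measure into the density
  \<open>f\<close> on the interval from \<open>x0\<close> to \<open>x0 + 2 * pi\<close>, where
  \<open>P\<close> undoes \<open>F\<close>. After wrapping by \<open>cis\<close> the integrand is
  periodic, so the interval may be moved back to the standard period.\<close>

lemma distr_quantile:
  fixes F f P :: "real \<Rightarrow> real"
  assumes deriv: "\<And>x. (F has_real_derivative f x) (at x)" and cont: "continuous_on UNIV f"
    and nonneg: "\<And>x. 0 \<le> f x" and per: "\<And>x. f (x + 2 * pi) = f x"
    and x0: "0 \<le> x0" "x0 \<le> 2 * pi"
    and P_meas [measurable]: "P \<in> borel_measurable borel"
    and P: "\<And>x. x \<in> {x0..x0 + 2 * pi} \<Longrightarrow> P (F x) = x"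
  shows "distr (restrict_space lborel {F x0..F (x0 + 2 * pi)}) circle_space (\<lambda>t. cis (P t))
       = distr (density period (\<lambda>x. ennreal (f x))) circle_space cis"
proof (rule measure_eqI)
  fix E assume "E \<in> sets (distr (restrict_space lborel {F x0..F (x0 + 2 * pi)}) circle_space (\<lambda>t. cis (P t)))"
  then have E [measurable]: "E \<in> sets circle_space" by simp
  note [measurable] = measurable_cis_circle
  have f_meas [measurable]: "f \<in> borel_measurable borel"
    using cont by (rule borel_measurable_continuous_onI)
  have ind [measurable]: "(\<lambda>x. indicator E (cis x) :: ennreal) \<in> borel_measurable borel"
    by measurable
  let ?I = "{F x0..F (x0 + 2 * pi)}"
  have emeasure_distr_eq: "emeasure (distr M circle_space h) E = (\<integral>\<^sup>+t. indicator E (h t) \<partial>M)"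
    if [measurable]: "h \<in> measurable M circle_space" for M :: "real measure" and h
    by (subst nn_integral_indicator[symmetric], simp, subst nn_integral_distr) auto
  have "emeasure (distr (restrict_space lborel ?I) circle_space (\<lambda>t. cis (P t))) E
      = (\<integral>\<^sup>+t. indicator E (cis (P t)) \<partial>restrict_space lborel ?I)"
    by (rule emeasure_distr_eq) (auto intro!: measurable_restrict_space1)
  also have "\<dots> = (\<integral>\<^sup>+t. indicator E (cis (P t)) * indicator ?I t \<partial>lborel)"
    by (simp add: nn_integral_restrict_space)
  also have "\<dots> = (\<integral>\<^sup>+x. indicator E (cis (P (F x))) * ennreal (f x) * indicator {x0..x0 + 2 * pi} x \<partial>lborel)"
    by (rule nn_integral_substitution_aux) (auto intro: deriv nonneg continuous_on_subset[OF cont])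
  also have "\<dots> = (\<integral>\<^sup>+x. (indicator E (cis x) * ennreal (f x)) * indicator {x0..x0 + 2 * pi} x \<partial>lborel)"
    by (intro nn_integral_cong) (auto simp: P split: split_indicator)
  also have "\<dots> = (\<integral>\<^sup>+x. indicator E (cis x) * ennreal (f x) \<partial>period)"
  proof (rule nn_integral_period_shift[OF _ _ x0])
    show "(\<lambda>x. indicator E (cis x) * ennreal (f x)) \<in> borel_measurable borel"
      by measurable
  qed (simp add: per cis_add_2pi)
  also have "\<dots> = (\<integral>\<^sup>+x. indicator E (cis x) \<partial>density period (\<lambda>x. ennreal (f x)))"
    by (subst nn_integral_density) (auto intro!: measurable_restrict_space1 simp: mult.commute)
  also have "\<dots> = emeasure (distr (density period (\<lambda>x. ennreal (f x))) circle_space cis) E"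
    by (rule emeasure_distr_eq[symmetric]) (auto intro!: measurable_restrict_space1)
  finally show "emeasure (distr (restrict_space lborel ?I) circle_space (\<lambda>t. cis (P t))) E
      = emeasure (distr (density period (\<lambda>x. ennreal (f x))) circle_space cis) E" .
qed simp

text \<open>Cutting the circle at a point where \<open>F - G\<close> is as close as possible to the level \<open>c\<close> makes mass
  transport across the cut unnecessary, without increasing the cost.\<close>

lemma ex_level_shift_le:
  fixes H :: "real \<Rightarrow> real"
  assumes cont: "continuous_on {a..b} H" and ab: "a \<le> b"
  shows "\<exists>x0\<in>{a..b}. \<forall>x\<in>{a..b}. \<bar>H x - H x0\<bar> \<le> \<bar>H x - c\<bar>"
proof -
  obtain m where m: "m \<in> {a..b}" "\<And>x. x \<in> {a..b} \<Longrightarrow> H m \<le> H x"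
    using continuous_attains_inf[OF compact_Icc _ cont] ab by auto
  obtain M where M: "M \<in> {a..b}" "\<And>x. x \<in> {a..b} \<Longrightarrow> H x \<le> H M"
    using continuous_attains_sup[OF compact_Icc _ cont] ab by auto
  \<comment> \<open>If \<open>c\<close> lies outside the range of \<open>H\<close>, the nearer
    extremum is the required level; if inside, \<open>c\<close> itself is attained.\<close>
  consider "c < H m" | "H M < c" | "H m \<le> c" "c \<le> H M" by linarith
  then show ?thesis
  proof cases
    case 1
    then show ?thesis using m by (intro bexI[of _ m]) (auto intro!: abs_leI dest: m(2))
  next
    case 2
    then show ?thesis using M by (intro bexI[of _ M]) (auto intro!: abs_leI dest: M(2))
  next
    case 3
    have "connected (H ` {a..b})"
      using cont by (intro connected_continuous_image) auto
    then have "c \<in> H ` {a..b}"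
      using 3 m(1) M(1) connectedD_interval[of "H ` {a..b}" "H m" "H M" c] by auto
    then show ?thesis by auto
  qed
qed

text \<open>\<open>F\<close> and \<open>G\<close> are distribution functions lifted to the line,
  gaining 1 per turn. Once the circle is cut at \<open>x0\<close> and both are normalised to vanish
  there, their quantiles, driven by the same uniform variable, couple the measures. The cost on the
  circle is at most the cost on the line, which is the area between the normalised
  functions.\<close>

lemma kantorovich_dist_le_integral_cdf:
  fixes F G f g :: "real \<Rightarrow> real"
  assumes F: "\<And>x. (F has_real_derivative f x) (at x)" "continuous_on UNIV f" "\<And>x. 0 \<le> f x"
      "\<And>x. f (x + 2 * pi) = f x" "strict_mono F" "\<And>x. F (x + 2 * pi) = F x + 1"
    and G: "\<And>x. (G has_real_derivative g x) (at x)" "continuous_on UNIV g" "\<And>x. 0 \<le> g x"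
      "\<And>x. g (x + 2 * pi) = g x" "strict_mono G" "\<And>x. G (x + 2 * pi) = G x + 1"
  shows "kantorovich_dist (distr (density period (\<lambda>x. ennreal (f x))) circle_space cis)
           (distr (density period (\<lambda>x. ennreal (g x))) circle_space cis)
       \<le> (\<integral>\<^sup>+x. ennreal \<bar>F x - G x - c\<bar> \<partial>period)"
proof -
  define \<mu> where "\<mu> = distr (density period (\<lambda>x. ennreal (f x))) circle_space cis"
  define \<nu> where "\<nu> = distr (density period (\<lambda>x. ennreal (g x))) circle_space cis"
  have FG_cont: "continuous_on S F" "continuous_on S G" for S
    using F(1) G(1) by (meson DERIV_continuous continuous_at_imp_continuous_on)+
  obtain x0 where x0: "0 \<le> x0" "x0 \<le> 2 * pi"
    and level: "\<And>x. x \<in> {0..2*pi} \<Longrightarrow> \<bar>(F x - G x) - (F x0 - G x0)\<bar> \<le> \<bar>(F x - G x) - c\<bar>"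
    using ex_level_shift_le[of 0 "2 * pi" "\<lambda>x. F x - G x" c] FG_cont by (force intro: continuous_on_diff)
  define b where "b = x0 + 2 * pi"
  define F0 where "F0 x = F x - F x0" for x
  define G0 where "G0 x = G x - G x0" for x
  have F0: "(F0 has_real_derivative f x) (at x)" "strict_mono F0" "F0 x0 = 0" "F0 b = 1" for x
    using F DERIV_diff[OF F(1)[of x] DERIV_const[of "F x0"]] by (auto simp: F0_def[abs_def] b_def strict_mono_def)
  have G0: "(G0 has_real_derivative g x) (at x)" "strict_mono G0" "G0 x0 = 0" "G0 b = 1" for x
    using G DERIV_diff[OF G(1)[of x] DERIV_const[of "G x0"]] by (auto simp: G0_def[abs_def] b_def strict_mono_def)
  have FG0_cont: "continuous_on S F0" "continuous_on S G0" for S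
    unfolding F0_def G0_def by (intro continuous_intros FG_cont)+
  have b: "x0 \<le> b" by (simp add: b_def)
  obtain P where P: "continuous_on UNIV P" "\<And>x. x \<in> {x0..b} \<Longrightarrow> P (F0 x) = x"
      "\<And>t. t \<in> {0..1} \<Longrightarrow> P t \<in> {x0..b} \<and> F0 (P t) = t"
    using continuous_quantile[OF FG0_cont(1) F0(2) b] unfolding F0(3,4) by metis
  obtain Q where Q: "continuous_on UNIV Q" "\<And>x. x \<in> {x0..b} \<Longrightarrow> Q (G0 x) = x"
      "\<And>t. t \<in> {0..1} \<Longrightarrow> Q t \<in> {x0..b} \<and> G0 (Q t) = t"
    using continuous_quantile[OF FG0_cont(2) G0(2) b] unfolding G0(3,4) by metis
  have [measurable]: "P \<in> borel_measurable borel" "Q \<in> borel_measurable borel"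
    using P(1) Q(1) by (auto intro: borel_measurable_continuous_onI)
  note [measurable] = measurable_cis_circle measurable_circle_borel
  have FG_meas [measurable]: "F \<in> borel_measurable borel" "G \<in> borel_measurable borel"
    using FG_cont by (auto intro: borel_measurable_continuous_onI)
  define U where "U = restrict_space lborel {0..1::real}"
  have U: "(\<lambda>t. cis (P t)) \<in> measurable U circle_space" "(\<lambda>t. cis (Q t)) \<in> measurable U circle_space"
    unfolding U_def by (intro measurable_restrict_space1; measurable)+
  have \<mu>: "distr U circle_space (\<lambda>t. cis (P t)) = \<mu>"
    unfolding U_def \<mu>_def
    using distr_quantile[OF F0(1) F(2,3,4) x0, of P] P(2) F0(3,4) by (simp add: b_def)
  have \<nu>: "distr U circle_space (\<lambda>t. cis (Q t)) = \<nu>"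
    unfolding U_def \<nu>_def
    using distr_quantile[OF G0(1) G(2,3,4) x0, of Q] Q(2) G0(3,4) by (simp add: b_def)
  define \<pi> where "\<pi> = distr U (circle_space \<Otimes>\<^sub>M circle_space) (\<lambda>t. (cis (P t), cis (Q t)))"
  have sets: "sets \<mu> = sets circle_space" "sets \<nu> = sets circle_space"
    by (simp_all add: \<mu>_def \<nu>_def)
  \<comment> \<open>\<open>distr\<close> depends on its target only through space and sigma-algebra,
    so \<open>\<mu>\<close> and \<open>\<nu>\<close> may be replaced by
    \<open>circle_space\<close>.\<close>
  have "distr \<pi> \<mu> fst = distr \<pi> circle_space fst" "distr \<pi> \<nu> snd = distr \<pi> circle_space snd"
    using sets by (auto intro!: distr_cong)
  moreover have "distr \<pi> circle_space fst = \<mu>" "distr \<pi> circle_space snd = \<nu>"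
    unfolding \<pi>_def \<mu>[symmetric] \<nu>[symmetric] using U
    by (subst distr_distr; simp add: comp_def)+
  moreover have "sets \<pi> = sets (\<mu> \<Otimes>\<^sub>M \<nu>)"
    using sets by (simp add: \<pi>_def cong: sets_pair_measure_cong)
  ultimately have "\<pi> \<in> couplings \<mu> \<nu>" by (simp add: couplings_def)
  then have "kantorovich_dist \<mu> \<nu> \<le> (\<integral>\<^sup>+p. ennreal (geodesic_dist (fst p) (snd p)) \<partial>\<pi>)"
    unfolding kantorovich_dist_def by (rule INF_lower)
  also have "\<dots> = (\<integral>\<^sup>+t. ennreal (geodesic_dist (cis (P t)) (cis (Q t))) \<partial>U)"
  proof -
    have "(\<lambda>p. fst p / snd p) \<in> borel_measurable (circle_space \<Otimes>\<^sub>M circle_space)"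
      using measurable_compose[OF measurable_fst measurable_circle_borel]
        measurable_compose[OF measurable_snd measurable_circle_borel]
      by (intro borel_measurable_divide) auto
    then show ?thesis
      unfolding \<pi>_def geodesic_dist_def using U by (subst nn_integral_distr) auto
  qed
  also have "\<dots> \<le> (\<integral>\<^sup>+t. ennreal \<bar>P t - Q t\<bar> \<partial>U)"
    by (intro nn_integral_mono ennreal_leI geodesic_dist_cis_le)
  also have "\<dots> = (\<integral>\<^sup>+t. ennreal \<bar>P t - Q t\<bar> * indicator {0..1} t \<partial>lborel)"
    by (simp add: U_def nn_integral_restrict_space)
  also have "\<dots> = (\<integral>\<^sup>+y. ennreal \<bar>F0 y - G0 y\<bar> * indicator {x0..b} y \<partial>lborel)"
    using P(3) Q(3) F0 G0 b by (intro nn_integral_abs_diff_quantiles) auto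
  \<comment> \<open>Both functions gain 1 per turn, so their difference is periodic and the cut can
    be moved back to 0.\<close>
  also have "\<dots> = (\<integral>\<^sup>+y. ennreal \<bar>F0 y - G0 y\<bar> \<partial>period)"
    unfolding b_def by (rule nn_integral_period_shift) (auto simp: F0_def G0_def F G x0)
  also have "\<dots> \<le> (\<integral>\<^sup>+x. ennreal \<bar>F x - G x - c\<bar> \<partial>period)"
  proof (intro nn_integral_mono ennreal_leI)
    fix x assume "x \<in> space period"
    then show "\<bar>F0 x - G0 x\<bar> \<le> \<bar>F x - G x - c\<bar>"
      using level[of x] by (simp add: space_restrict_space F0_def G0_def algebra_simps)
  qed
  finally show ?thesis by (simp add: \<mu>_def \<nu>_def)
qed


subsection \<open>Distribution functions of states\<close>

text \<open>Multiplication by \<open>z ^ n\<close> turns the symbol into a polynomial whose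
  coefficient at \<open>n\<close> is \<open>\<phi> 0 = 1\<close>. It has finitely many roots,
  whereas an arc has infinitely many points. This will make the distribution functions strictly
  increasing.\<close>

lemma symbol_nonzero_on_arc:
  assumes "n > 0" "\<phi> 0 = 1" "a < b"
  shows "\<exists>x\<in>{a<..<b}. symbol n \<phi> (cis x) \<noteq> 0"
proof (rule ccontr)
  assume "\<not> ?thesis"
  then have zero: "symbol n \<phi> (cis x) = 0" if "x \<in> {a<..<b}" for x
    using that by auto
  define p where "p = (\<Sum>k\<in>{- int n<..<int n}. monom (\<phi> k) (nat (k + int n)))"
  have "poly p (cis x) = cis x ^ n * symbol n \<phi> (cis x)" for x
  proof -
    have "\<phi> k * cis x ^ nat (k + int n) = cis x ^ n * (\<phi> k * cis x powi k)"
      if "k \<in> {- int n<..<int n}" for k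
    proof -
      have "cis x ^ nat (k + int n) = cis x powi (k + int n)"
        using that by (simp add: power_int_def)
      also have "\<dots> = cis x powi k * cis x ^ n"
        by (simp add: power_int_add)
      finally show ?thesis by simp
    qed
    then show ?thesis
      unfolding p_def symbol_def poly_sum poly_monom sum_distrib_left by (intro sum.cong) auto
  qed
  \<comment> \<open>The arc is shortened to length at most pi so that \<open>cis\<close> is
    injective on it.\<close>
  with zero have "cis ` {a<..<min b (a + pi)} \<subseteq> {z. poly p z = 0}"
    by auto
  moreover have "inj_on cis {a<..<min b (a + pi)}"
  proof (rule inj_onI)
    fix x y assume xy: "x \<in> {a<..<min b (a + pi)}" "y \<in> {a<..<min b (a + pi)}" "cis x = cis y"
    then have "cis (x - y) = 1" by (simp flip: cis_divide)
    moreover have "x - y \<in> {- pi<..pi}" using xy by auto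
    ultimately show "x = y" using Arg_cis[of "x - y"] by simp
  qed
  moreover have "infinite {a<..<min b (a + pi)}"
    using \<open>a < b\<close> pi_gt_zero by (intro infinite_Ioo) auto
  ultimately have "infinite {z. poly p z = 0}"
    using finite_imageD finite_subset by blast
  then have "p = 0" using poly_roots_finite by blast
  moreover have "coeff p n = (\<Sum>k\<in>{- int n<..<int n}. if k = 0 then \<phi> k else 0)"
    unfolding p_def coeff_sum by (intro sum.cong) auto
  ultimately show False using assms by simp
qed

lemma symbol_diff_fun: "symbol n (a - b) z = symbol n a z - symbol n b z"
  by (simp add: symbol_def left_diff_distrib sum_subtractf)

lemma symbol_const_seq: "n > 0 \<Longrightarrow> symbol n (const_seq c) z = of_real c"
proof -
  assume "n > 0"
  have "symbol n (const_seq c) z = (\<Sum>k\<in>{- int n<..<int n}. if k = 0 then of_real c else 0)"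
    unfolding symbol_def by (intro sum.cong) (auto simp: const_seq_def)
  then show ?thesis using \<open>n > 0\<close> by simp
qed

text \<open>A distribution function of the state's measure up to an additive constant, for
  \<open>\<Phi>\<close> a primitive of the state minus 1. The term \<open>x\<close> integrates the
  constant coefficient 1; the minus sign arises because \<open>\<partial>^t\<close> acts on symbols
  as minus the derivative.\<close>

definition state_cdf :: "nat \<Rightarrow> (int \<Rightarrow> complex) \<Rightarrow> real \<Rightarrow> real" where
  "state_cdf n \<Phi> x = (x - Re (symbol n \<Phi> (cis x))) / (2 * pi)"

lemma state_cdf_deriv:
  assumes n: "n > 0" and \<Phi>: "is_primitive n \<Phi> (\<phi> - const_seq 1)"
  shows "(state_cdf n \<Phi> has_real_derivative Re (symbol n \<phi> (cis x)) / (2 * pi)) (at x)"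
proof -
  have coeff: "\<phi> k - const_seq 1 k = - \<i> * of_int k * \<Phi> k" for k
    using \<Phi> by (auto simp: is_primitive_def derivation_transpose_eq fun_eq_iff)
  \<comment> \<open>The symbol is differentiated as an entire function of \<open>z\<close> and then
    restricted to the real line.\<close>
  have "((\<lambda>z. \<Sum>k\<in>{- int n<..<int n}. \<Phi> k * exp (\<i> * of_int k * z)) has_field_derivative
      (\<Sum>k\<in>{- int n<..<int n}. \<Phi> k * (\<i> * of_int k * exp (\<i> * of_int k * of_real x)))) (at (of_real x))"
    by (intro DERIV_sum) (auto intro!: derivative_eq_intros)
  then have "((\<lambda>x. \<Sum>k\<in>{- int n<..<int n}. \<Phi> k * exp (\<i> * of_int k * of_real x)) has_vector_derivative
      (\<Sum>k\<in>{- int n<..<int n}. \<Phi> k * (\<i> * of_int k * exp (\<i> * of_int k * of_real x)))) (at x)"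
    by (rule has_vector_derivative_real_field)
  moreover have "exp (\<i> * of_int k * of_real x) = cis (of_int k * x)" for k x
    by (simp add: cis_conv_exp mult.assoc)
  ultimately have "((\<lambda>x. symbol n \<Phi> (cis x)) has_vector_derivative
      (\<Sum>k\<in>{- int n<..<int n}. \<Phi> k * (\<i> * of_int k * cis (of_int k * x)))) (at x)"
    by (simp add: symbol_cis)
  moreover have "(\<Sum>k\<in>{- int n<..<int n}. \<Phi> k * (\<i> * of_int k * cis (of_int k * x)))
      = - symbol n (\<phi> - const_seq 1) (cis x)"
    by (simp add: symbol_cis coeff sum_negf[symmetric] mult_ac)
  ultimately have "((\<lambda>x. symbol n \<Phi> (cis x)) has_vector_derivative - (symbol n \<phi> (cis x) - 1)) (at x)"
    by (simp add: symbol_diff_fun symbol_const_seq[OF n])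
  from bounded_linear.has_vector_derivative[OF bounded_linear_Re this]
  have "((\<lambda>x. Re (symbol n \<Phi> (cis x))) has_real_derivative Re (- (symbol n \<phi> (cis x) - 1))) (at x)"
    by (simp add: has_real_derivative_iff_has_vector_derivative)
  from DERIV_cdivide[OF DERIV_diff[OF DERIV_ident this], of "2 * pi"]
  show ?thesis by (simp add: state_cdf_def[abs_def])
qed

lemma circle_measure_cdf:
  assumes n: "n > 0" and \<phi>: "\<phi> \<in> states n" and \<Phi>: "is_primitive n \<Phi> (\<phi> - const_seq 1)"
  defines "f \<equiv> \<lambda>x. Re (symbol n \<phi> (cis x)) / (2 * pi)"
  shows "(state_cdf n \<Phi> has_real_derivative f x) (at x)" "continuous_on UNIV f" "0 \<le> f x"
    "f (x + 2 * pi) = f x" "strict_mono (state_cdf n \<Phi>)"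
    "state_cdf n \<Phi> (x + 2 * pi) = state_cdf n \<Phi> x + 1"
proof -
  show deriv: "(state_cdf n \<Phi> has_real_derivative f x) (at x)" for x
    unfolding f_def using n \<Phi> by (rule state_cdf_deriv)
  show "continuous_on UNIV f"
    unfolding f_def symbol_cis by (intro continuous_intros) auto
  show nonneg: "0 \<le> f x" for x
    using state_symbol_nonneg[OF \<phi>, of "cis x"] by (simp add: f_def less_eq_complex_def)
  show "f (x + 2 * pi) = f x" by (simp add: f_def cis_add_2pi)
  show "state_cdf n \<Phi> (x + 2 * pi) = state_cdf n \<Phi> x + 1"
    unfolding state_cdf_def cis_add_2pi by (simp add: field_simps)
  have mono: "state_cdf n \<Phi> a \<le> state_cdf n \<Phi> b" if "a \<le> b" for a b
    using that deriv nonneg by (blast intro: DERIV_nonneg_imp_nondecreasing)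
  show "strict_mono (state_cdf n \<Phi>)"
  proof (rule strict_monoI, rule ccontr)
    \<comment> \<open>Failure of strictness makes the function constant between \<open>a\<close> and
      \<open>b\<close>, so its derivative, the density, vanishes on an arc; the symbol of a state
      cannot.\<close>
    fix a b :: real assume ab: "a < b" "\<not> state_cdf n \<Phi> a < state_cdf n \<Phi> b"
    have const: "state_cdf n \<Phi> x = state_cdf n \<Phi> a" if "x \<in> {a<..<b}" for x
      using mono[of a x] mono[of x b] that ab by auto
    have "f x = 0" if x: "x \<in> {a<..<b}" for x
    proof -
      have "((\<lambda>x. state_cdf n \<Phi> a) has_real_derivative f x) (at x)"
        by (rule DERIV_cong_ev[THEN iffD1, OF refl _ refl deriv])
           (use x in \<open>auto intro!: eventually_nhds_in_open[THEN eventually_mono, of "{a<..<b}"] const\<close>)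
      then show ?thesis using DERIV_unique DERIV_const by blast
    qed
    moreover have "symbol n \<phi> (cis x) = of_real (2 * pi * f x)" for x
      using state_symbol_nonneg[OF \<phi>, of "cis x"] by (simp add: f_def less_eq_complex_def complex_eq_iff)
    ultimately show False
      using symbol_nonzero_on_arc[of n \<phi> a b] n state_zero_coeff[OF n \<phi>] ab(1) by auto
  qed
qed

text \<open>In the difference of the two distribution functions the terms \<open>x\<close> cancel,
  leaving the symbol of \<open>\<Psi> - \<Phi>\<close> over 2 pi. The level
  \<open>c / (2 * pi)\<close> then corresponds to subtracting the constant \<open>c\<close>, and the
  transport bound becomes the normalised L1 norm.\<close>

lemma kantorovich_dist_le_dual_norm:
  assumes n: "n > 0" and \<phi>: "\<phi> \<in> states n" and \<psi>: "\<psi> \<in> states n"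
    and \<Phi>: "is_primitive n \<Phi> (\<phi> - const_seq 1)" and \<Psi>: "is_primitive n \<Psi> (\<psi> - const_seq 1)"
  shows "kantorovich_dist (circle_measure n \<phi>) (circle_measure n \<psi>)
       \<le> ennreal (dual_norm n (\<Psi> - \<Phi> - const_seq c))"
proof -
  let ?a = "\<Psi> - \<Phi> - const_seq c"
  have a: "hermitian_seq ?a"
    using \<Phi> \<Psi> by (auto simp: is_primitive_def dual_seq_sa_def hermitian_seq_def const_seq_def)
  note cdf = circle_measure_cdf[OF n \<phi> \<Phi>] circle_measure_cdf[OF n \<psi> \<Psi>]
  have "kantorovich_dist (circle_measure n \<phi>) (circle_measure n \<psi>)
      \<le> (\<integral>\<^sup>+x. ennreal \<bar>state_cdf n \<Phi> x - state_cdf n \<Psi> x - c / (2 * pi)\<bar> \<partial>period)"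
    unfolding circle_measure_def by (rule kantorovich_dist_le_integral_cdf; rule cdf)
  also have "\<dots> = (\<integral>\<^sup>+x. ennreal (\<bar>Re (symbol n ?a (cis x))\<bar> / (2 * pi)) \<partial>period)"
  proof (intro nn_integral_cong arg_cong[where f = ennreal])
    fix x
    have "state_cdf n \<Phi> x - state_cdf n \<Psi> x - c / (2 * pi) = Re (symbol n ?a (cis x)) / (2 * pi)"
      by (simp add: state_cdf_def symbol_diff_fun symbol_const_seq[OF n] field_simps)
    then show "\<bar>state_cdf n \<Phi> x - state_cdf n \<Psi> x - c / (2 * pi)\<bar> = \<bar>Re (symbol n ?a (cis x))\<bar> / (2 * pi)"
      by (simp add: abs_divide)
  qed
  also have "\<dots> = ennreal (\<integral>x. \<bar>Re (symbol n ?a (cis x))\<bar> / (2 * pi) \<partial>period)"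
  proof (rule nn_integral_eq_integral)
    have "cmod (symbol n ?a (cis x)) \<le> (\<Sum>k\<in>{- int n<..<int n}. cmod (?a k))" for x
      unfolding symbol_cis by (rule order_trans[OF norm_sum]) (simp add: norm_mult)
    then have "\<bar>Re (symbol n ?a (cis x))\<bar> \<le> (\<Sum>k\<in>{- int n<..<int n}. cmod (?a k))" for x
      using abs_Re_le_cmod order_trans by blast
    then have "integrable period (\<lambda>x. \<bar>Re (symbol n ?a (cis x))\<bar>)"
      by (intro integrable_period) auto
    then show "integrable period (\<lambda>x. \<bar>Re (symbol n ?a (cis x))\<bar> / (2 * pi))"
      by simp
  qed simp
  also have "\<dots> \<le> ennreal (dual_norm n ?a)"
    using integral_symbol_le_dual_norm[OF a, of n] by (intro ennreal_leI) (simp add: field_simps)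
  finally show ?thesis .
qed

theorem theorem4p20:
  fixes n :: nat and \<phi> \<psi> :: "int \<Rightarrow> complex"
  assumes "n > 0" and "\<phi> \<in> states n" and "\<psi> \<in> states n"
  shows "(\<forall>\<Phi> \<Psi> r. is_primitive n \<Phi> (\<phi> - const_seq r) \<and> is_primitive n \<Psi> (\<psi> - const_seq r) \<longrightarrow>
            state_dist n \<phi> \<psi> = (INF c :: real. dual_norm n (\<Psi> - \<Phi> - const_seq c)))
       \<and> kantorovich_dist (circle_measure n \<phi>) (circle_measure n \<psi>) \<le> ennreal (state_dist n \<phi> \<psi>)"
proof (intro conjI allI impI)
  show "state_dist n \<phi> \<psi> = (INF c :: real. dual_norm n (\<Psi> - \<Phi> - const_seq c))"
    if "is_primitive n \<Phi> (\<phi> - const_seq r) \<and> is_primitive n \<Psi> (\<psi> - const_seq r)" for \<Phi> \<Psi> r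
    using that assms(1) state_dist_eq_INF_dual_norm by blast
next
  \<comment> \<open>States have constant term 1, so subtracting \<open>const_seq 1\<close> leaves
    functionals that do have primitives.\<close>
  obtain \<Phi> \<Psi> where prim: "is_primitive n \<Phi> (\<phi> - const_seq 1)" "is_primitive n \<Psi> (\<psi> - const_seq 1)"
    using state_primitive assms by meson
  let ?K = "kantorovich_dist (circle_measure n \<phi>) (circle_measure n \<psi>)"
  have K_le: "?K \<le> ennreal (dual_norm n (\<Psi> - \<Phi> - const_seq c))" for c
    by (rule kantorovich_dist_le_dual_norm[OF assms prim])
  \<comment> \<open>A single finite bound shows that the transport cost is a real number
    \<open>k\<close>, so the infimum over \<open>c\<close> can be taken among the reals.\<close>
  obtain k where k: "?K = ennreal k" "0 \<le> k"
    using iffD1[OF le_ennreal_iff[OF dual_norm_nonneg] K_le[of 0]] by blast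
  have "k \<le> (INF c. dual_norm n (\<Psi> - \<Phi> - const_seq c))"
    using K_le by (intro cINF_greatest) (auto simp: k ennreal_le_iff dual_norm_nonneg)
  then show "?K \<le> ennreal (state_dist n \<phi> \<psi>)"
    using state_dist_eq_INF_dual_norm[OF assms(1) prim] by (simp add: k ennreal_leI)
qed

end
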